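(* Let $M$ be a matroid and let $\mathcal{Z}(M)$ be its lattice of cyclic flats. Suppose that (a) $\mathcal{Z}(M)$ has dimension at most two, and (b) for each antichain $\mathcal{A}$ of $\mathcal{Z}(M)$, the sublattice of $\mathcal{Z}(M)$ generated by $\mathcal{A}$ is distributive. Then $M$ and all of its minors, as well as the duals of all of these matroids, are transversal.
   Context: All matroids are finite. A flat $X$ of a matroid $M$ is cyclic if the restriction $M|X$ has no isthmuses (equivalently, $X$ is a union of circuits). The cyclic flats of $M$, ordered by inclusion, form a (finite) lattice $\mathcal{Z}(M)$; in it, $A\lor B=\mathrm{cl}(A\cup B)$, and $A\land B$ is the union of the circuits contained in $A\cap B$. The dimension of an ordered set $P$ is the least number of chains whose product contains an order-embedding of $P$. An antichain is a set of pairwise incomparable elements. *)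

theory Defs
  imports Main "HOL-Library.FuncSet" "HOL-Library.Extended_Nat"
begin

section \<open>Matroids\<close>

record 'a set_system =
  ground :: "'a set"
  indep :: "'a set set"

locale matroid =
  fixes M :: "'a set_system"
  assumes finite_ground: "finite (ground M)"
    and indep_subset_ground: "I \<in> indep M \<Longrightarrow> I \<subseteq> ground M"
    and empty_indep: "{} \<in> indep M"
    and indep_hereditary: "I \<in> indep M \<Longrightarrow> J \<subseteq> I \<Longrightarrow> J \<in> indep M"
    and indep_augment: "I \<in> indep M \<Longrightarrow> J \<in> indep M \<Longrightarrow> card I < card J \<Longrightarrow>
      \<exists>e \<in> J - I. insert e I \<in> indep M"

definition bases :: "'a set_system \<Rightarrow> 'a set set" where
  "bases M = {B \<in> indep M. \<forall>I \<in> indep M. B \<subseteq> I \<longrightarrow> I = B}"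

definition circuits :: "'a set_system \<Rightarrow> 'a set set" where
  "circuits M = {C. C \<subseteq> ground M \<and> C \<notin> indep M \<and> (\<forall>D. D \<subset> C \<longrightarrow> D \<in> indep M)}"

definition rank :: "'a set_system \<Rightarrow> 'a set \<Rightarrow> nat" where
  "rank M X = Max (card ` {I \<in> indep M. I \<subseteq> X})"

definition cl :: "'a set_system \<Rightarrow> 'a set \<Rightarrow> 'a set" where
  "cl M X = {e \<in> ground M. rank M (insert e X) = rank M X}"

definition flat :: "'a set_system \<Rightarrow> 'a set \<Rightarrow> bool" where
  "flat M X \<longleftrightarrow> X \<subseteq> ground M \<and> cl M X = X"

definition isthmus :: "'a set_system \<Rightarrow> 'a \<Rightarrow> bool" where
  "isthmus M e \<longleftrightarrow> e \<in> ground M \<and> (\<forall>B \<in> bases M. e \<in> B)"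

definition restriction :: "'a set_system \<Rightarrow> 'a set \<Rightarrow> 'a set_system" where
  "restriction M X = \<lparr>ground = ground M \<inter> X, indep = {I \<in> indep M. I \<subseteq> X}\<rparr>"

definition deletion :: "'a set_system \<Rightarrow> 'a set \<Rightarrow> 'a set_system" where
  "deletion M X = restriction M (ground M - X)"

definition dual_matroid :: "'a set_system \<Rightarrow> 'a set_system" where
  "dual_matroid M =
    \<lparr>ground = ground M, indep = {I. \<exists>B \<in> bases M. I \<subseteq> ground M - B}\<rparr>"

definition contraction :: "'a set_system \<Rightarrow> 'a set \<Rightarrow> 'a set_system" where
  "contraction M X = dual_matroid (deletion (dual_matroid M) X)"

inductive minor :: "'a set_system \<Rightarrow> 'a set_system \<Rightarrow> bool" for M where
  minor_refl: "minor M M"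
| minor_deletion: "minor M N \<Longrightarrow> X \<subseteq> ground N \<Longrightarrow> minor M (deletion N X)"
| minor_contraction: "minor M N \<Longrightarrow> X \<subseteq> ground N \<Longrightarrow> minor M (contraction N X)"

definition partial_transversal :: "nat \<Rightarrow> (nat \<Rightarrow> 'a set) \<Rightarrow> 'a set \<Rightarrow> bool" where
  "partial_transversal n A I \<longleftrightarrow>
    (\<exists>\<phi>. inj_on \<phi> I \<and> (\<forall>e \<in> I. \<phi> e < n \<and> e \<in> A (\<phi> e)))"

definition transversal :: "'a set_system \<Rightarrow> bool" where
  "transversal M \<longleftrightarrow>
    (\<exists>n A. (\<forall>j < n. A j \<subseteq> ground M) \<and> indep M = {I. partial_transversal n A I})"


section \<open>Order dimension\<close>

text \<open>
  The chains may be taken on the element type of the ordered set itself: a chain in a product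
  that contains a copy of \<open>P\<close> can be cut down to the projection of that copy, which has at most as
  many elements as \<open>P\<close>.  The dimension is \<open>\<infinity>\<close> if no finite number of chains suffices.
\<close>

definition embeds_in_chain_product :: "nat \<Rightarrow> 'b::order set \<Rightarrow> bool" where
  "embeds_in_chain_product n P \<longleftrightarrow>
    (\<exists>(C :: nat \<Rightarrow> 'b set) (r :: nat \<Rightarrow> 'b rel) (f :: 'b \<Rightarrow> nat \<Rightarrow> 'b).
      (\<forall>i < n. linear_order_on (C i) (r i)) \<and>
      f \<in> P \<rightarrow> PiE {..<n} C \<and>
      (\<forall>x \<in> P. \<forall>y \<in> P. x \<le> y \<longleftrightarrow> (\<forall>i < n. (f x i, f y i) \<in> r i)))"

definition order_dim :: "'b::order set \<Rightarrow> enat" where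
  "order_dim P = Inf {enat n | n. embeds_in_chain_product n P}"

definition antichain :: "'b::order set \<Rightarrow> bool" where
  "antichain S \<longleftrightarrow> (\<forall>x \<in> S. \<forall>y \<in> S. x \<le> y \<longrightarrow> x = y)"


section \<open>The lattice of cyclic flats\<close>

definition cyclic_flats :: "'a set_system \<Rightarrow> 'a set set" where
  "cyclic_flats M = {X. flat M X \<and> \<not> (\<exists>e. isthmus (restriction M X) e)}"

definition cf_join :: "'a set_system \<Rightarrow> 'a set \<Rightarrow> 'a set \<Rightarrow> 'a set" where
  "cf_join M A B = cl M (A \<union> B)"

definition cf_meet :: "'a set_system \<Rightarrow> 'a set \<Rightarrow> 'a set \<Rightarrow> 'a set" where
  "cf_meet M A B = \<Union> {C \<in> circuits M. C \<subseteq> A \<inter> B}"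

inductive_set cf_sublattice :: "'a set_system \<Rightarrow> 'a set set \<Rightarrow> 'a set set" for M S where
  generator: "X \<in> S \<Longrightarrow> X \<in> cf_sublattice M S"
| join: "X \<in> cf_sublattice M S \<Longrightarrow> Y \<in> cf_sublattice M S \<Longrightarrow> cf_join M X Y \<in> cf_sublattice M S"
| meet: "X \<in> cf_sublattice M S \<Longrightarrow> Y \<in> cf_sublattice M S \<Longrightarrow> cf_meet M X Y \<in> cf_sublattice M S"

definition cf_distributive :: "'a set_system \<Rightarrow> 'a set set \<Rightarrow> bool" where
  "cf_distributive M L \<longleftrightarrow>
    (\<forall>X \<in> L. \<forall>Y \<in> L. \<forall>Z \<in> L.
      cf_meet M X (cf_join M Y Z) = cf_join M (cf_meet M X Y) (cf_meet M X Z))"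


section \<open>Joins and meets of cyclic flats\<close>

context matroid
begin

lemma finite_indep: "I \<in> indep M \<Longrightarrow> finite I"
  using finite_ground indep_subset_ground finite_subset by blast

lemma finite_indeps: "finite {I \<in> indep M. I \<subseteq> X}"
  by (rule finite_subset[of _ "Pow (ground M)"])
    (use finite_ground indep_subset_ground in auto)

lemma card_le_rank: "I \<in> indep M \<Longrightarrow> I \<subseteq> X \<Longrightarrow> card I \<le> rank M X"
  unfolding rank_def by (rule Max_ge) (use finite_indeps in auto)

lemma rank_attained: "\<exists>I \<in> indep M. I \<subseteq> X \<and> card I = rank M X"
proof -
  have "rank M X \<in> card ` {I \<in> indep M. I \<subseteq> X}"
    unfolding rank_def by (rule Max_in) (use finite_indeps empty_indep in auto)
  then show ?thesis by auto
qed

lemma rank_mono: "X \<subseteq> Y \<Longrightarrow> rank M X \<le> rank M Y"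
  by (metis rank_attained card_le_rank order_trans)

lemma indep_extend:
  assumes "I \<in> indep M" "I \<subseteq> X"
  shows "\<exists>B \<in> indep M. I \<subseteq> B \<and> B \<subseteq> X \<and> card B = rank M X"
  using assms
proof (induction "rank M X - card I" arbitrary: I rule: less_induct)
  case less
  show ?case
  proof (cases "card I = rank M X")
    case True
    then show ?thesis using less.prems by auto
  next
    case False
    then have lt: "card I < rank M X" using card_le_rank[OF less.prems] by simp
    obtain J where J: "J \<in> indep M" "J \<subseteq> X" "card J = rank M X" using rank_attained by blast
    then obtain e where e: "e \<in> J - I" "insert e I \<in> indep M"
      using indep_augment less.prems lt by metis
    have "rank M X - card (insert e I) < rank M X - card I"
      using e lt finite_indep[OF less.prems(1)] by simp
    moreover have "insert e I \<subseteq> X" using e J less.prems by auto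
    ultimately obtain B where "B \<in> indep M" "insert e I \<subseteq> B" "B \<subseteq> X" "card B = rank M X"
      using less.hyps[of "insert e I"] e by blast
    then show ?thesis by auto
  qed
qed

lemma circuit_in_dependent:
  assumes "X \<subseteq> ground M" "X \<notin> indep M"
  shows "\<exists>C \<in> circuits M. C \<subseteq> X"
proof -
  have "finite {D. D \<subseteq> X \<and> D \<notin> indep M}"
    by (rule finite_subset[of _ "Pow (ground M)"]) (use assms finite_ground in auto)
  then obtain C where C: "C \<in> {D. D \<subseteq> X \<and> D \<notin> indep M}"
    "\<forall>D \<in> {D. D \<subseteq> X \<and> D \<notin> indep M}. D \<subseteq> C \<longrightarrow> C = D"
    using finite_has_minimal[of "{D. D \<subseteq> X \<and> D \<notin> indep M}"] assms by auto
  then have "C \<in> circuits M" unfolding circuits_def using assms by blast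
  then show ?thesis using C by auto
qed

lemma circuit_minus_indep: "C \<in> circuits M \<Longrightarrow> x \<in> C \<Longrightarrow> C - {x} \<in> indep M"
  unfolding circuits_def by auto

lemma circuit_not_subset_indep: "C \<in> circuits M \<Longrightarrow> I \<in> indep M \<Longrightarrow> \<not> C \<subseteq> I"
  unfolding circuits_def using indep_hereditary by auto

lemma fundamental_circuit:
  assumes "I \<in> indep M" "x \<in> ground M" "insert x I \<notin> indep M"
  shows "\<exists>C \<in> circuits M. x \<in> C \<and> C \<subseteq> insert x I"
proof -
  obtain C where C: "C \<in> circuits M" "C \<subseteq> insert x I"
    using circuit_in_dependent assms indep_subset_ground by (metis insert_subset)
  then show ?thesis using circuit_not_subset_indep[of C I] assms by auto
qed

lemma cl_circuit:
  assumes "x \<in> cl M X" "x \<notin> X"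
  shows "\<exists>C \<in> circuits M. x \<in> C \<and> C \<subseteq> insert x X"
proof -
  obtain B where B: "B \<in> indep M" "B \<subseteq> X" "card B = rank M X" using rank_attained by blast
  have "insert x B \<notin> indep M"
  proof
    assume "insert x B \<in> indep M"
    then have "card (insert x B) \<le> rank M (insert x X)" using B by (intro card_le_rank) auto
    moreover have "finite B" "x \<notin> B" using finite_indep B assms by auto
    ultimately show False using assms(1) B(3) by (simp add: cl_def)
  qed
  then show ?thesis using fundamental_circuit[of B x] B assms by (auto simp: cl_def)
qed

lemma circuit_cl:
  assumes "C \<in> circuits M" "x \<in> C" "C \<subseteq> insert x X"
  shows "x \<in> cl M X"
proof -
  have xg: "x \<in> ground M" using assms by (auto simp: circuits_def)
  obtain B where B: "B \<in> indep M" "C - {x} \<subseteq> B" "B \<subseteq> X" "card B = rank M X"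
    using indep_extend[of "C - {x}" X] circuit_minus_indep assms by auto
  have "rank M (insert x X) \<le> rank M X"
  proof (rule ccontr)
    assume "\<not> ?thesis"
    moreover obtain D where D: "D \<in> indep M" "D \<subseteq> insert x X" "card D = rank M (insert x X)"
      using rank_attained by blast
    ultimately obtain e where e: "e \<in> D - B" "insert e B \<in> indep M"
      using indep_augment[of B D] B by auto
    have "e \<notin> X"
      using card_le_rank[of "insert e B" X] e B finite_indep[of B] by auto
    then have "C \<subseteq> insert e B" using e D B by auto
    then show False using e circuit_not_subset_indep assms by blast
  qed
  then show ?thesis
    using xg rank_mono[OF subset_insertI, of X x] by (simp add: cl_def)
qed

lemma subset_cl: "X \<subseteq> ground M \<Longrightarrow> X \<subseteq> cl M X"
  by (auto simp: cl_def insert_absorb)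

lemma cl_mono:
  assumes "X \<subseteq> Y" "Y \<subseteq> ground M"
  shows "cl M X \<subseteq> cl M Y"
proof
  fix x assume x: "x \<in> cl M X"
  show "x \<in> cl M Y"
  proof (cases "x \<in> X")
    case True
    then show ?thesis using subset_cl assms by blast
  next
    case False
    then obtain C where "C \<in> circuits M" "x \<in> C" "C \<subseteq> insert x X" using x cl_circuit by blast
    then show ?thesis using circuit_cl assms by (meson insert_mono order_trans)
  qed
qed

lemma rank_cl:
  assumes "X \<subseteq> ground M"
  shows "rank M (cl M X) = rank M X"
proof (rule antisym)
  obtain B where B: "B \<in> indep M" "B \<subseteq> X" "card B = rank M X" using rank_attained by blast
  show "rank M (cl M X) \<le> rank M X"
  proof (rule ccontr)
    assume "\<not> ?thesis"
    moreover obtain D where D: "D \<in> indep M" "D \<subseteq> cl M X" "card D = rank M (cl M X)"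
      using rank_attained by blast
    ultimately obtain e where e: "e \<in> D - B" "insert e B \<in> indep M"
      using indep_augment[of B D] B by auto
    have "card (insert e B) \<le> rank M (insert e X)" using e B by (intro card_le_rank) auto
    also have "\<dots> = rank M X" using e D by (auto simp: cl_def)
    finally show False using e B finite_indep[of B] by auto
  qed
  show "rank M X \<le> rank M (cl M X)" using rank_mono subset_cl assms by blast
qed

lemma cl_cl:
  assumes "X \<subseteq> ground M"
  shows "cl M (cl M X) = cl M X"
proof
  have sub: "cl M X \<subseteq> ground M" by (auto simp: cl_def)
  show "cl M X \<subseteq> cl M (cl M X)" using subset_cl sub by blast
  show "cl M (cl M X) \<subseteq> cl M X"
  proof
    fix e assume e: "e \<in> cl M (cl M X)"
    have "rank M (insert e X) \<le> rank M (insert e (cl M X))"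
      using subset_cl assms by (intro rank_mono) auto
    also have "\<dots> = rank M X" using e rank_cl assms by (auto simp: cl_def)
    finally show "e \<in> cl M X"
      using e rank_mono[OF subset_insertI, of X e] by (simp add: cl_def)
  qed
qed

lemma isthmus_restriction_iff:
  assumes "X \<subseteq> ground M"
  shows "isthmus (restriction M X) e \<longleftrightarrow> e \<in> X \<and> \<not> (\<exists>C \<in> circuits M. e \<in> C \<and> C \<subseteq> X)"
proof (cases "e \<in> X")
  case True
  have "(\<forall>B \<in> bases (restriction M X). e \<in> B) \<longleftrightarrow> \<not> (\<exists>C \<in> circuits M. e \<in> C \<and> C \<subseteq> X)"
  proof
    assume L: "\<forall>B \<in> bases (restriction M X). e \<in> B"
    show "\<not> (\<exists>C \<in> circuits M. e \<in> C \<and> C \<subseteq> X)"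
    proof
      assume "\<exists>C \<in> circuits M. e \<in> C \<and> C \<subseteq> X"
      then obtain C where C: "C \<in> circuits M" "e \<in> C" "C \<subseteq> X" by blast
      then obtain B where B: "B \<in> indep M" "C - {e} \<subseteq> B" "B \<subseteq> X" "card B = rank M X"
        using indep_extend[of "C - {e}" X] circuit_minus_indep by auto
      have "I = B" if "I \<in> indep M" "I \<subseteq> X" "B \<subseteq> I" for I
        using card_seteq[of I B] card_le_rank[of I X] finite_indep[of I] that B by auto
      then have "B \<in> bases (restriction M X)"
        using B by (auto simp: bases_def restriction_def)
      then have "C \<subseteq> B" using L B by auto
      then show False using circuit_not_subset_indep C B by blast
    qed
  next
    assume R: "\<not> (\<exists>C \<in> circuits M. e \<in> C \<and> C \<subseteq> X)"
    show "\<forall>B \<in> bases (restriction M X). e \<in> B"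
    proof (rule ccontr)
      assume "\<not> ?thesis"
      then obtain B where B: "B \<in> bases (restriction M X)" "e \<notin> B" by blast
      then have "B \<in> indep M" "B \<subseteq> X" "insert e B \<notin> indep M"
        using True by (auto simp: bases_def restriction_def)
      then show False using fundamental_circuit[of B e] True R assms by blast
    qed
  qed
  then show ?thesis using True assms by (auto simp: isthmus_def restriction_def)
next
  case False
  then show ?thesis by (auto simp: isthmus_def restriction_def)
qed

lemma cyclic_flats_iff:
  "X \<in> cyclic_flats M \<longleftrightarrow> flat M X \<and> (\<forall>x \<in> X. \<exists>C \<in> circuits M. x \<in> C \<and> C \<subseteq> X)"
proof (cases "flat M X")
  case True
  then have "X \<subseteq> ground M" by (simp add: flat_def)
  then show ?thesis
    unfolding cyclic_flats_def mem_Collect_eq isthmus_restriction_iff[OF \<open>X \<subseteq> ground M\<close>]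
    using True by blast
qed (simp add: cyclic_flats_def)

lemma cf_join_cyclic_flat:
  assumes "A \<in> cyclic_flats M" "B \<in> cyclic_flats M"
  shows "cf_join M A B \<in> cyclic_flats M"
proof -
  have sub: "A \<union> B \<subseteq> ground M" using assms by (auto simp: cyclic_flats_def flat_def)
  have "flat M (cl M (A \<union> B))" unfolding flat_def using cl_cl[OF sub] by (auto simp: cl_def)
  moreover have "\<exists>C \<in> circuits M. x \<in> C \<and> C \<subseteq> cl M (A \<union> B)" if x: "x \<in> cl M (A \<union> B)" for x
  proof (cases "x \<in> A \<union> B")
    case True
    then have "\<exists>C \<in> circuits M. x \<in> C \<and> C \<subseteq> A \<union> B"
      using assms unfolding cyclic_flats_iff by blast
    then show ?thesis using subset_cl[OF sub] by blast
  next
    case False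
    then show ?thesis using cl_circuit[OF x] subset_cl[OF sub] x by blast
  qed
  ultimately show ?thesis by (auto simp: cyclic_flats_iff cf_join_def)
qed

lemma cf_join_upper:
  assumes "A \<in> cyclic_flats M" "B \<in> cyclic_flats M"
  shows "A \<subseteq> cf_join M A B" "B \<subseteq> cf_join M A B"
  using subset_cl[of "A \<union> B"] assms by (auto simp: cyclic_flats_def flat_def cf_join_def)

lemma cf_join_least:
  assumes "F \<in> cyclic_flats M" "A \<subseteq> F" "B \<subseteq> F"
  shows "cf_join M A B \<subseteq> F"
  using cl_mono[of "A \<union> B" F] assms by (auto simp: cyclic_flats_def flat_def cf_join_def)

lemma cf_meet_cyclic_flat:
  assumes "A \<in> cyclic_flats M" "B \<in> cyclic_flats M"
  shows "cf_meet M A B \<in> cyclic_flats M"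
proof -
  let ?U = "cf_meet M A B"
  have g: "A \<subseteq> ground M" "B \<subseteq> ground M" "cl M A = A" "cl M B = B"
    using assms by (auto simp: cyclic_flats_def flat_def)
  have U: "?U \<subseteq> A" "?U \<subseteq> B" by (auto simp: cf_meet_def)
  have "cl M ?U \<subseteq> ?U"
  proof
    fix x assume x: "x \<in> cl M ?U"
    then have xAB: "x \<in> A \<inter> B" using cl_mono[of ?U A] cl_mono[of ?U B] U g by auto
    show "x \<in> ?U"
    proof (rule ccontr)
      assume "x \<notin> ?U"
      then obtain C where C: "C \<in> circuits M" "x \<in> C" "C \<subseteq> insert x ?U"
        using cl_circuit x by blast
      then have "C \<subseteq> A \<inter> B" using xAB U by blast
      then have "x \<in> ?U" unfolding cf_meet_def using C by blast
      then show False using \<open>x \<notin> ?U\<close> by contradiction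
    qed
  qed
  then have "flat M ?U" unfolding flat_def using subset_cl[of ?U] U g by auto
  moreover have "\<exists>C \<in> circuits M. x \<in> C \<and> C \<subseteq> ?U" if "x \<in> ?U" for x
    using that unfolding cf_meet_def by blast
  ultimately show ?thesis by (simp add: cyclic_flats_iff)
qed

lemma cf_meet_lower: "cf_meet M A B \<subseteq> A" "cf_meet M A B \<subseteq> B"
  by (auto simp: cf_meet_def)

lemma cf_meet_greatest:
  assumes "F \<in> cyclic_flats M" "F \<subseteq> A" "F \<subseteq> B"
  shows "F \<subseteq> cf_meet M A B"
proof
  fix x assume "x \<in> F"
  then obtain C where "C \<in> circuits M" "x \<in> C" "C \<subseteq> F"
    using assms(1) cyclic_flats_iff by blast
  then show "x \<in> cf_meet M A B" unfolding cf_meet_def using assms(2,3) by blast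
qed

end

end

theory Submission
  imports Defs
begin

text \<open>
  List an antichain of cyclic flats from left to right in the planar lattice. For three members
  \<open>A, B, C\<close> in this order, distributivity of the sublattice they generate gives
  \<open>B \<le> (A \<and> B) \<or> C\<close> and its order dual. The first of these conditions passes to contractions, because
  \<open>Z(M/Y)\<close> embeds in \<open>Z(M)\<close> so that meets are preserved and joins only grow, and it implies
  that \<open>M\<close> is transversal: it yields the Mason--Ingleton inequalities, which say that the function
  \<open>\<beta>\<close> on cyclic flats with \<open>\<Sum>Y \<ge> X. \<beta> Y = r(M) - r(X)\<close> is nonnegative and that the complements
  of the cyclic flats \<open>F\<close>, taken \<open>\<beta> F\<close> times each, satisfy Hall's condition on independent sets.
  Restrictions of transversal matroids are transversal, so all minors of \<open>M\<close> are. The order dual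
  condition gives the same for the minors of the dual matroid, as its cyclic flats are the
  complements of those of \<open>M\<close>.
\<close>

section \<open>Hall's marriage theorem\<close>

text \<open>Induction on the size of the family. A tight nonempty proper subfamily \<open>J\<close>
  is matched on its own, and the others are matched outside its neighbourhood. If there is none,
  every nonempty proper subfamily has an element to spare, so one choice may be made
  arbitrarily.\<close>

lemma hall:
  fixes N :: "'i \<Rightarrow> 'b set"
  assumes "finite I" "\<And>i. i \<in> I \<Longrightarrow> finite (N i)"
    and "\<And>J. J \<subseteq> I \<Longrightarrow> card J \<le> card (\<Union>i\<in>J. N i)"
  shows "\<exists>\<phi>. inj_on \<phi> I \<and> (\<forall>i\<in>I. \<phi> i \<in> N i)"
  using assms
proof (induction "card I" arbitrary: I N rule: less_induct)
  case less
  note fin = less.prems(1) less.prems(2) and hall = less.prems(3)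
  show ?case
  proof (cases "\<exists>J. J \<noteq> {} \<and> J \<subset> I \<and> card (\<Union>i\<in>J. N i) \<le> card J")
    case True
    then obtain J where J: "J \<noteq> {}" "J \<subset> I" "card (\<Union>i\<in>J. N i) \<le> card J" by blast
    let ?U = "\<Union>i\<in>J. N i"
    have finJ: "finite J" using J fin(1) by (meson finite_subset psubset_imp_subset)
    have "\<exists>\<phi>. inj_on \<phi> J \<and> (\<forall>i\<in>J. \<phi> i \<in> N i)"
      by (rule less.hyps) (use J fin hall in \<open>auto intro: psubset_card_mono finite_subset\<close>)
    then obtain \<phi> where \<phi>: "inj_on \<phi> J" "\<forall>i\<in>J. \<phi> i \<in> N i" by blast
    have "\<exists>\<psi>. inj_on \<psi> (I - J) \<and> (\<forall>i\<in>I - J. \<psi> i \<in> N i - ?U)"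
    proof (rule less.hyps)
      show "card (I - J) < card I" using J fin by (intro psubset_card_mono) auto
      fix K assume K: "K \<subseteq> I - J"
      have finK: "finite K" using K fin by (auto intro: finite_subset)
      \<comment> \<open>Hall's condition outside \<open>?U\<close>: use it for
        \<open>J \<union> K\<close> and cancel \<open>J\<close>, whose neighbourhood has at most
        \<open>card J\<close> elements.\<close>
      have "card J + card K = card (J \<union> K)"
        using K finJ finK by (subst card_Un_disjoint) auto
      also have "\<dots> \<le> card (\<Union>i\<in>J \<union> K. N i)" using K J by (intro hall) auto
      also have "(\<Union>i\<in>J \<union> K. N i) = ?U \<union> (\<Union>i\<in>K. N i - ?U)" by auto
      also have "card \<dots> \<le> card ?U + card (\<Union>i\<in>K. N i - ?U)" by (rule card_Un_le)
      finally show "card K \<le> card (\<Union>i\<in>K. N i - ?U)" using J(3) by simp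
    qed (use fin in auto)
    then obtain \<psi> where \<psi>: "inj_on \<psi> (I - J)" "\<forall>i\<in>I - J. \<psi> i \<in> N i - ?U" by blast
    let ?\<chi> = "\<lambda>i. if i \<in> J then \<phi> i else \<psi> i"
    have "inj_on ?\<chi> I"
    proof (rule inj_onI)
      fix x y assume xy: "x \<in> I" "y \<in> I" "?\<chi> x = ?\<chi> y"
      show "x = y"
      proof (cases "x \<in> J"; cases "y \<in> J")
        assume "x \<in> J" "y \<notin> J"
        then have "\<phi> x = \<psi> y" "\<phi> x \<in> ?U" "\<psi> y \<notin> ?U"
          using xy(3) bspec[OF \<psi>(2), of y] \<phi>(2) xy(2) by auto
        then show ?thesis by simp
      next
        assume "x \<notin> J" "y \<in> J"
        then have "\<psi> x = \<phi> y" "\<phi> y \<in> ?U" "\<psi> x \<notin> ?U"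
          using xy(3) bspec[OF \<psi>(2), of x] \<phi>(2) xy(1) by auto
        then show ?thesis by simp
      qed (use xy \<phi>(1) \<psi>(1) in \<open>auto dest: inj_onD\<close>)
    qed
    moreover have "\<forall>i\<in>I. ?\<chi> i \<in> N i" using \<phi> \<psi> by auto
    ultimately show ?thesis by blast
  next
    case False
    show ?thesis
    proof (cases "I = {}")
      case False
      then obtain e where e: "e \<in> I" by blast
      have "card {e} \<le> card (\<Union>i\<in>{e}. N i)" using e by (intro hall) auto
      then obtain x where x: "x \<in> N e" by (cases "N e = {}") auto
      have "\<exists>\<psi>. inj_on \<psi> (I - {e}) \<and> (\<forall>i\<in>I - {e}. \<psi> i \<in> N i - {x})"
      proof (rule less.hyps)
        show "card (I - {e}) < card I" using e fin by (intro psubset_card_mono) auto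
        fix K assume K: "K \<subseteq> I - {e}"
        have "card K \<le> card ((\<Union>i\<in>K. N i) - {x})"
        proof (cases "K = {}")
          case False
          then have "card K < card (\<Union>i\<in>K. N i)"
            using K e \<open>\<not> (\<exists>J. J \<noteq> {} \<and> J \<subset> I \<and> card (\<Union>i\<in>J. N i) \<le> card J)\<close>
            by (metis Diff_empty insert_Diff1 insert_Diff_single linorder_not_le psubsetI
                subset_Diff_insert subset_insert_iff)
          then show ?thesis by (auto simp: card_Diff_singleton_if)
        qed simp
        also have "(\<Union>i\<in>K. N i) - {x} = (\<Union>i\<in>K. N i - {x})" by auto
        finally show "card K \<le> card (\<Union>i\<in>K. N i - {x})" .
      qed (use fin in auto)
      then obtain \<psi> where \<psi>: "inj_on \<psi> (I - {e})" "\<forall>i\<in>I - {e}. \<psi> i \<in> N i - {x}" by blast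
      have "inj_on (\<psi>(e := x)) I" using \<psi> e by (auto simp: inj_on_def)
      moreover have "\<forall>i\<in>I. (\<psi>(e := x)) i \<in> N i" using \<psi> x by auto
      ultimately show ?thesis by blast
    qed simp
  qed
qed

section \<open>Rank functions of duals and minors\<close>

lemma ground_restriction [simp]: "ground (restriction M X) = ground M \<inter> X"
  by (simp add: restriction_def)

lemma ground_deletion [simp]: "ground (deletion M X) = ground M - X"
  by (auto simp: deletion_def)

lemma ground_dual_matroid [simp]: "ground (dual_matroid M) = ground M"
  by (simp add: dual_matroid_def)

lemma ground_contraction [simp]: "ground (contraction M X) = ground M - X"
  by (simp add: contraction_def)

lemma rank_restriction: "X \<subseteq> S \<Longrightarrow> rank (restriction M S) X = rank M X"
  unfolding rank_def restriction_def by (rule arg_cong[of _ _ Max]) auto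

lemma restriction_restriction:
  "restriction (restriction M S) T = restriction M (S \<inter> T)"
  by (auto simp: restriction_def)

context matroid
begin

lemma rank_indep:
  assumes "I \<in> indep M"
  shows "rank M I = card I"
proof -
  obtain J where "J \<in> indep M" "J \<subseteq> I" "card J = rank M I" using rank_attained by blast
  then have "rank M I \<le> card I" using card_mono[of I J] finite_indep assms by auto
  then show ?thesis using card_le_rank[of I I] assms by simp
qed

lemma indep_iff_rank:
  assumes "I \<subseteq> ground M"
  shows "I \<in> indep M \<longleftrightarrow> rank M I = card I"
proof
  assume c: "rank M I = card I"
  obtain J where J: "J \<in> indep M" "J \<subseteq> I" "card J = rank M I" using rank_attained by blast
  moreover have "finite I" using assms finite_ground finite_subset by blast
  ultimately have "J = I" using c card_subset_eq by metis
  then show "I \<in> indep M" using J by simp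
qed (rule rank_indep)

lemma rank_insert_le: "rank M (insert e X) \<le> Suc (rank M X)"
proof -
  obtain J where J: "J \<in> indep M" "J \<subseteq> insert e X" "card J = rank M (insert e X)"
    using rank_attained by blast
  have "card (J - {e}) \<le> rank M X"
    using J indep_hereditary[of J "J - {e}"] by (intro card_le_rank) auto
  then show ?thesis using J by (auto simp: card_Diff_singleton_if split: if_splits)
qed

text \<open>Extend a basis of \<open>X \<inter> Y\<close> to a basis of \<open>X \<union> Y\<close>
  and count the traces of the latter on \<open>X\<close> and on \<open>Y\<close>.\<close>

lemma rank_submodular: "rank M (X \<inter> Y) + rank M (X \<union> Y) \<le> rank M X + rank M Y"
proof -
  obtain I where I: "I \<in> indep M" "I \<subseteq> X \<inter> Y" "card I = rank M (X \<inter> Y)"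
    using rank_attained by blast
  then obtain B where B: "B \<in> indep M" "I \<subseteq> B" "B \<subseteq> X \<union> Y" "card B = rank M (X \<union> Y)"
    using indep_extend[of I "X \<union> Y"] by auto
  have fin: "finite B" using B finite_indep by blast
  have BX: "card (B \<inter> X) \<le> rank M X" "card (B \<inter> Y) \<le> rank M Y"
    using B indep_hereditary by (auto intro: card_le_rank)
  have "card (B \<inter> X) + card (B \<inter> Y) = card ((B \<inter> X) \<union> (B \<inter> Y)) + card ((B \<inter> X) \<inter> (B \<inter> Y))"
    using fin by (intro card_Un_Int) auto
  also have "(B \<inter> X) \<union> (B \<inter> Y) = B" using B by auto
  finally have "card (B \<inter> X) + card (B \<inter> Y) = card B + card ((B \<inter> X) \<inter> (B \<inter> Y))" .
  moreover have "card I \<le> card ((B \<inter> X) \<inter> (B \<inter> Y))" using I B fin by (intro card_mono) auto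
  ultimately show ?thesis using BX I B by linarith
qed

text \<open>Submodularity for \<open>insert e X\<close> and \<open>Y\<close>, whose intersection
  contains \<open>X\<close>.\<close>

lemma rank_insert_mono:
  assumes "X \<subseteq> Y" "rank M (insert e X) = rank M X"
  shows "rank M (insert e Y) = rank M Y"
proof (cases "e \<in> Y")
  case False
  have "rank M X \<le> rank M (insert e X \<inter> Y)" using assms by (intro rank_mono) auto
  moreover have "insert e X \<union> Y = insert e Y" using assms by auto
  ultimately have "rank M (insert e Y) \<le> rank M Y"
    using rank_submodular[of "insert e X" Y] assms by simp
  then show ?thesis using rank_mono[OF subset_insertI, of Y e] by simp
qed (simp add: insert_absorb)

lemma flat_cl: "X \<subseteq> ground M \<Longrightarrow> flat M (cl M X)"
  using cl_cl by (auto simp: flat_def cl_def)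

lemma bases_iff: "B \<in> bases M \<longleftrightarrow> B \<in> indep M \<and> card B = rank M (ground M)"
proof
  assume B: "B \<in> bases M"
  then obtain B' where "B' \<in> indep M" "B \<subseteq> B'" "card B' = rank M (ground M)"
    using indep_extend[of B "ground M"] indep_subset_ground by (auto simp: bases_def)
  then show "B \<in> indep M \<and> card B = rank M (ground M)" using B by (auto simp: bases_def)
next
  assume B: "B \<in> indep M \<and> card B = rank M (ground M)"
  have "I = B" if "I \<in> indep M" "B \<subseteq> I" for I
    using card_seteq[of I B] card_le_rank[of I "ground M"] finite_indep[of I]
      indep_subset_ground that B by auto
  then show "B \<in> bases M" using B by (auto simp: bases_def)
qed

section \<open>The dual matroid and its rank function\<close>

lemma indep_dual_iff:
  "I \<in> indep (dual_matroid M) \<longleftrightarrow> I \<subseteq> ground M \<and> rank M (ground M - I) = rank M (ground M)"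
proof
  assume "I \<in> indep (dual_matroid M)"
  then obtain B where B: "B \<in> bases M" "I \<subseteq> ground M - B" by (auto simp: dual_matroid_def)
  then have "card B \<le> rank M (ground M - I)"
    using indep_subset_ground[of B] by (intro card_le_rank) (auto simp: bases_def)
  then show "I \<subseteq> ground M \<and> rank M (ground M - I) = rank M (ground M)"
    using B rank_mono[of "ground M - I" "ground M"] by (auto simp: bases_iff)
next
  assume I: "I \<subseteq> ground M \<and> rank M (ground M - I) = rank M (ground M)"
  obtain B where B: "B \<in> indep M" "B \<subseteq> ground M - I" "card B = rank M (ground M - I)"
    using rank_attained by blast
  then show "I \<in> indep (dual_matroid M)"
    using I unfolding dual_matroid_def by (auto simp: bases_iff intro!: bexI[of _ B])
qed

lemma matroid_restriction: "matroid (restriction M S)"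
proof
  fix I J assume "I \<in> indep (restriction M S)" "J \<in> indep (restriction M S)" "card I < card J"
  then show "\<exists>e\<in>J - I. insert e I \<in> indep (restriction M S)"
    using indep_augment[of I J] by (auto simp: restriction_def)
qed (use finite_ground empty_indep indep_subset_ground indep_hereditary in
    \<open>auto simp: restriction_def\<close>)

text \<open>For the augmentation, \<open>B'\<close> is a basis avoiding \<open>J\<close>, and
  \<open>B\<close> is a basis that avoids \<open>I\<close> and extends \<open>B' - I\<close>. Any
  element of \<open>J - I\<close> outside \<open>B\<close> can be added to \<open>I\<close>. If
  \<open>B\<close> contained all of \<open>J - I\<close>, it would be larger than \<open>B'\<close>,
  because \<open>I - J\<close> is smaller than \<open>J - I\<close>.\<close>

lemma matroid_dual: "matroid (dual_matroid M)"
proof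
  show "{} \<in> indep (dual_matroid M)" by (simp add: indep_dual_iff)
next
  fix I J assume I: "I \<in> indep (dual_matroid M)" and "J \<subseteq> I"
  then show "J \<in> indep (dual_matroid M)" by (auto simp: dual_matroid_def)
next
  fix I J
  assume I: "I \<in> indep (dual_matroid M)" and J: "J \<in> indep (dual_matroid M)"
    and less: "card I < card J"
  obtain B' where B': "B' \<in> indep M" "B' \<subseteq> ground M - J" "card B' = rank M (ground M)"
    using J rank_attained[of "ground M - J"] by (auto simp: indep_dual_iff)
  have "B' - I \<in> indep M" using B' indep_hereditary by blast
  then obtain B where B: "B \<in> indep M" "B' - I \<subseteq> B" "B \<subseteq> ground M - I"
      "card B = rank M (ground M)"
    using indep_extend[of "B' - I" "ground M - I"] B' I by (auto simp: indep_dual_iff)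
  have fin: "finite I" "finite J" "finite B" "finite B'"
    using I J B B' finite_ground finite_indep by (auto simp: indep_dual_iff intro: finite_subset)
  have "\<not> J - I \<subseteq> B"
  proof
    assume "J - I \<subseteq> B"
    then have "card ((B' - I) \<union> (J - I)) \<le> card B" using B fin by (intro card_mono) auto
    moreover have "card ((B' - I) \<union> (J - I)) = card (B' - I) + card (J - I)"
      using B' fin by (intro card_Un_disjoint) auto
    moreover have "card B' \<le> card (B' - I) + card (I - J)"
    proof -
      have "card B' \<le> card ((B' - I) \<union> (I - J))" using B' fin by (intro card_mono) auto
      then show ?thesis using card_Un_le order_trans by blast
    qed
    moreover have "card (I - J) < card (J - I)" using less fin by (intro card_less_sym_Diff)
    ultimately show False using B B' by simp
  qed
  then obtain e where e: "e \<in> J - I" "e \<notin> B" by blast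
  have "card B \<le> rank M (ground M - insert e I)" using B e by (intro card_le_rank) auto
  then have "rank M (ground M - insert e I) = rank M (ground M)"
    using B rank_mono[of "ground M - insert e I" "ground M"] by auto
  then have "insert e I \<in> indep (dual_matroid M)"
    using I J e by (auto simp: indep_dual_iff)
  then show "\<exists>e\<in>J - I. insert e I \<in> indep (dual_matroid M)" using e by blast
qed (use finite_ground in \<open>auto simp: indep_dual_iff\<close>)

lemma rank_dual:
  assumes X: "X \<subseteq> ground M"
  shows "rank (dual_matroid M) X + rank M (ground M) = card X + rank M (ground M - X)"
proof -
  interpret D: matroid "dual_matroid M" by (rule matroid_dual)
  have finX: "finite X" using X finite_ground finite_subset by blast
  \<comment> \<open>Lower bound: a basis that extends a largest independent subset of the complement
    of \<open>X\<close> leaves as much of \<open>X\<close> free as possible.\<close>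
  obtain B0 where B0: "B0 \<in> indep M" "B0 \<subseteq> ground M - X" "card B0 = rank M (ground M - X)"
    using rank_attained by blast
  then obtain B where B: "B \<in> indep M" "B0 \<subseteq> B" "B \<subseteq> ground M" "card B = rank M (ground M)"
    using indep_extend[of B0 "ground M"] by auto
  have finB: "finite B" using B finite_indep by blast
  have "X - B \<in> indep (dual_matroid M)"
    using B X unfolding dual_matroid_def by (auto simp: bases_iff intro!: bexI[of _ B])
  then have "card (X - B) \<le> rank (dual_matroid M) X" by (rule D.card_le_rank) auto
  moreover have "card X = card (X - B) + card (X \<inter> B)"
    using finX by (metis card_Int_Diff add.commute)
  moreover have "card B = card (B - X) + card (X \<inter> B)"
    using finB by (metis card_Int_Diff add.commute inf_commute)
  moreover have "card B0 \<le> card (B - X)" using B0 B finB by (intro card_mono) auto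
  ultimately have ge: "card X + rank M (ground M - X) \<le>
      rank (dual_matroid M) X + rank M (ground M)"
    using B0 B by linarith
  \<comment> \<open>Upper bound: a basis \<open>B\<close> avoiding \<open>I\<close> meets
    \<open>X\<close> only in \<open>X - I\<close>, and its part outside \<open>X\<close> is
    independent.\<close>
  obtain I where I: "I \<in> indep (dual_matroid M)" "I \<subseteq> X" "card I = rank (dual_matroid M) X"
    using D.rank_attained by blast
  obtain B where B: "B \<in> indep M" "B \<subseteq> ground M - I" "card B = rank M (ground M)"
    using I(1) rank_attained[of "ground M - I"] by (auto simp: indep_dual_iff)
  have finB: "finite B" using B finite_indep by blast
  have "card I + card (X \<inter> B) \<le> card X"
  proof -
    have "card I + card (X \<inter> B) = card (I \<union> (X \<inter> B))"
      using I B finX finite_subset by (subst card_Un_disjoint) auto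
    also have "\<dots> \<le> card X" using I finX by (intro card_mono) auto
    finally show ?thesis .
  qed
  moreover have "card B = card (B - X) + card (X \<inter> B)"
    using finB by (metis card_Int_Diff add.commute inf_commute)
  moreover have "card (B - X) \<le> rank M (ground M - X)"
    using B indep_hereditary by (intro card_le_rank) auto
  ultimately show ?thesis using ge I B by linarith
qed

text \<open>\<open>I\<close> is independent in the double dual iff its complement has full dual
  rank; by \<open>rank_dual\<close> this says that the rank of \<open>I\<close> is its size.\<close>

lemma dual_dual: "dual_matroid (dual_matroid M) = M"
proof -
  interpret D: matroid "dual_matroid M" by (rule matroid_dual)
  have "I \<in> indep (dual_matroid (dual_matroid M)) \<longleftrightarrow> I \<in> indep M" for I
  proof (cases "I \<subseteq> ground M")
    case True
    then have "ground M - (ground M - I) = I" by auto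
    moreover have "card (ground M - I) + card I = card (ground M)"
      using True finite_ground finite_subset
      by (metis add.commute card_Diff_subset card_mono le_add_diff_inverse)
    ultimately show ?thesis
      using D.indep_dual_iff[of I] rank_dual[of "ground M - I"] rank_dual[of "ground M"] True
        indep_iff_rank[of I] rank_indep[OF empty_indep] by auto
  next
    case False
    then show ?thesis using D.indep_dual_iff[of I] indep_subset_ground[of I] by auto
  qed
  then have "indep (dual_matroid (dual_matroid M)) = indep M" by blast
  then show ?thesis by (simp add: set_system.equality)
qed

section \<open>Deletion and contraction\<close>

lemma matroid_deletion: "matroid (deletion M X)"
  by (simp add: deletion_def matroid_restriction)

lemma matroid_contraction: "matroid (contraction M X)"
  unfolding contraction_def
  by (intro matroid.matroid_dual matroid.matroid_deletion matroid_dual)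

text \<open>The dual rank formula is used once in the deletion of the dual and twice in
  \<open>M\<close>. Stating the result with sums avoids truncated subtraction.\<close>

lemma rank_contraction:
  assumes Y: "Y \<subseteq> ground M" and X: "X \<subseteq> ground M - Y"
  shows "rank (contraction M Y) X + rank M Y = rank M (X \<union> Y)"
proof -
  let ?E = "ground M"
  interpret D: matroid "dual_matroid M" by (rule matroid_dual)
  interpret L: matroid "deletion (dual_matroid M) Y" by (rule D.matroid_deletion)
  have del: "rank (deletion (dual_matroid M) Y) Z = rank (dual_matroid M) Z" if "Z \<subseteq> ?E - Y" for Z
    using that by (simp add: deletion_def rank_restriction)
  have "rank (contraction M Y) X + rank (dual_matroid M) (?E - Y) =
      card X + rank (dual_matroid M) (?E - Y - X)"
    using L.rank_dual[of X] X by (simp add: contraction_def del)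
  moreover have "rank (dual_matroid M) (?E - Y) + rank M ?E = card (?E - Y) + rank M Y"
    using rank_dual[of "?E - Y"] Y by (simp add: double_diff)
  moreover have "?E - (?E - Y - X) = X \<union> Y" using X Y by auto
  then have "rank (dual_matroid M) (?E - Y - X) + rank M ?E =
      card (?E - Y - X) + rank M (X \<union> Y)"
    using rank_dual[of "?E - Y - X"] by (simp add: Diff_subset subset_trans[OF Diff_subset])
  moreover have "card (?E - Y) = card X + card (?E - Y - X)"
    using X finite_ground
    by (metis card_Diff_subset card_mono finite_Diff finite_subset le_add_diff_inverse)
  ultimately show ?thesis by linarith
qed

text \<open>Lets a contraction pass inside a restriction, so that every minor can be kept in the
  form of a restriction. On both sides the rank of \<open>I\<close> is that of
  \<open>I \<union> Y\<close> minus that of \<open>Y\<close>.\<close>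

lemma contraction_restriction:
  assumes "Y \<subseteq> ground M \<inter> S"
  shows "contraction (restriction M S) Y = restriction (contraction M Y) (S - Y)"
proof -
  interpret R: matroid "restriction M S" by (rule matroid_restriction)
  interpret C: matroid "contraction M Y" by (rule matroid_contraction)
  interpret RC: matroid "contraction (restriction M S) Y" by (rule R.matroid_contraction)
  interpret CR: matroid "restriction (contraction M Y) (S - Y)" by (rule C.matroid_restriction)
  have "I \<in> indep (contraction (restriction M S) Y) \<longleftrightarrow>
      I \<in> indep (restriction (contraction M Y) (S - Y))" for I
  proof (cases "I \<subseteq> ground M \<inter> S - Y")
    case True
    have "rank (contraction (restriction M S) Y) I + rank M Y = rank M (I \<union> Y)"
      using R.rank_contraction[of Y I] True assms rank_restriction[of "I \<union> Y" S M]
        rank_restriction[of Y S M] by auto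
    moreover have "rank (restriction (contraction M Y) (S - Y)) I + rank M Y = rank M (I \<union> Y)"
      using rank_contraction[of Y I] True assms by (subst rank_restriction) auto
    ultimately have "rank (contraction (restriction M S) Y) I =
        rank (restriction (contraction M Y) (S - Y)) I"
      by linarith
    then show ?thesis using RC.indep_iff_rank[of I] CR.indep_iff_rank[of I] True by auto
  next
    case False
    then show ?thesis
      using RC.indep_subset_ground[of I] CR.indep_subset_ground[of I] by auto
  qed
  then have "indep (contraction (restriction M S) Y) =
      indep (restriction (contraction M Y) (S - Y))"
    by blast
  then show ?thesis by (intro set_system.equality) auto
qed

text \<open>Duality exchanges deletion and contraction. This reduces the duals of minors of
  \<open>M\<close> to minors of its dual.\<close>

lemma minor_dual:
  assumes "minor M N"
  shows "matroid N \<and> minor (dual_matroid M) (dual_matroid N)"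
  using assms
proof induction
  case minor_refl
  show ?case by (simp add: matroid_axioms minor.minor_refl)
next
  case (minor_deletion N X)
  then interpret N: matroid N by simp
  have "dual_matroid (deletion N X) = contraction (dual_matroid N) X"
    by (simp add: contraction_def N.dual_dual)
  then show ?case
    using minor_deletion minor.minor_contraction[of "dual_matroid M" "dual_matroid N" X]
      N.matroid_deletion by simp
next
  case (minor_contraction N X)
  then interpret N: matroid N by simp
  interpret L: matroid "deletion (dual_matroid N) X"
    by (intro matroid.matroid_deletion N.matroid_dual)
  have "dual_matroid (contraction N X) = deletion (dual_matroid N) X"
    by (simp add: contraction_def L.dual_dual)
  then show ?case
    using minor_contraction minor.minor_deletion[of "dual_matroid M" "dual_matroid N" X]
      N.matroid_contraction by simp
qed

end

section \<open>Cyclic flats of duals and contractions\<close>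

context matroid
begin

lemma circuit_through_iff:
  assumes "x \<in> X" "X \<subseteq> ground M"
  shows "(\<exists>C\<in>circuits M. x \<in> C \<and> C \<subseteq> X) \<longleftrightarrow> rank M (X - {x}) = rank M X"
proof -
  have "(\<exists>C\<in>circuits M. x \<in> C \<and> C \<subseteq> X) \<longleftrightarrow> x \<in> cl M (X - {x})"
    using cl_circuit[of x "X - {x}"] circuit_cl[of _ x "X - {x}"] assms
    by (auto simp: insert_absorb)
  then show ?thesis using assms by (auto simp: cl_def insert_absorb)
qed

lemma flat_iff_rank:
  "flat M X \<longleftrightarrow> X \<subseteq> ground M \<and> (\<forall>e\<in>ground M - X. rank M (insert e X) \<noteq> rank M X)"
  by (auto simp: flat_def cl_def insert_absorb)

text \<open>A form without circuits, to which the rank formulas for duals and contractions apply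
  directly.\<close>

lemma cyclic_flats_iff_rank:
  "X \<in> cyclic_flats M \<longleftrightarrow> X \<subseteq> ground M \<and>
    (\<forall>e\<in>ground M - X. rank M (insert e X) \<noteq> rank M X) \<and> (\<forall>e\<in>X. rank M (X - {e}) = rank M X)"
  using circuit_through_iff unfolding cyclic_flats_iff flat_iff_rank by blast

lemma cyclic_flat_subset_ground: "X \<in> cyclic_flats M \<Longrightarrow> X \<subseteq> ground M"
  by (simp add: cyclic_flats_iff_rank)

lemma finite_cyclic_flats: "finite (cyclic_flats M)"
  using cyclic_flat_subset_ground finite_ground by (auto intro: finite_subset[of _ "Pow (ground M)"])

lemma cl_subset_cyclic_flat: "F \<in> cyclic_flats M \<Longrightarrow> X \<subseteq> F \<Longrightarrow> cl M X \<subseteq> F"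
  using cl_mono[of X F] by (auto simp: cyclic_flats_def flat_def)

text \<open>An element of the closure is spanned by the other elements of \<open>X\<close>: by
  hypothesis if it lies in \<open>X\<close>, by the definition of closure otherwise. Hence it is not
  an isthmus of the closure.\<close>

lemma cl_cyclic_flat:
  assumes "X \<subseteq> ground M" "\<And>x. x \<in> X \<Longrightarrow> rank M (X - {x}) = rank M X"
  shows "cl M X \<in> cyclic_flats M"
proof -
  have "rank M (cl M X - {e}) = rank M (cl M X)" if e: "e \<in> cl M X" for e
  proof -
    have "rank M (insert e (X - {e})) = rank M (X - {e})"
      using assms e by (cases "e \<in> X") (auto simp: insert_absorb cl_def)
    then have "rank M (insert e (cl M X - {e})) = rank M (cl M X - {e})"
      by (rule rank_insert_mono[rotated]) (use subset_cl[OF assms(1)] in auto)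
    then show ?thesis using e by (simp add: insert_absorb)
  qed
  then show ?thesis
    using flat_cl[OF assms(1)] unfolding cyclic_flats_iff_rank flat_iff_rank by blast
qed

text \<open>\<open>cf_meet M X X\<close> is the union of the circuits in \<open>X\<close>. A circuit
  that puts \<open>x\<close> into its closure lies in the flat \<open>X\<close>, so \<open>x\<close>
  already belongs to the union.\<close>

lemma cyclic_part_of_flat:
  assumes X: "flat M X"
  shows "cf_meet M X X \<in> cyclic_flats M"
proof -
  let ?U = "cf_meet M X X"
  have g: "X \<subseteq> ground M" "cl M X = X" using X by (auto simp: flat_def)
  have U: "?U \<subseteq> X" by (rule cf_meet_lower)
  have "cl M ?U \<subseteq> ?U"
  proof
    fix x assume x: "x \<in> cl M ?U"
    then have "x \<in> X" using cl_mono[of ?U X] U g by auto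
    show "x \<in> ?U"
    proof (rule ccontr)
      assume "x \<notin> ?U"
      then obtain C where C: "C \<in> circuits M" "x \<in> C" "C \<subseteq> insert x ?U"
        using cl_circuit x by blast
      then have "C \<subseteq> X" using \<open>x \<in> X\<close> U by blast
      then show False using C \<open>x \<notin> ?U\<close> unfolding cf_meet_def by blast
    qed
  qed
  then have "flat M ?U" using subset_cl[of ?U] U g by (auto simp: flat_def)
  moreover have "\<exists>C \<in> circuits M. x \<in> C \<and> C \<subseteq> ?U" if "x \<in> ?U" for x
    using that unfolding cf_meet_def by blast
  ultimately show ?thesis by (simp add: cyclic_flats_iff)
qed

text \<open>By the dual rank formula, adding \<open>e\<close> to \<open>X\<close> raises the dual
  rank iff removing \<open>e\<close> from the complement keeps its rank. So being a flat and having
  no isthmus change places under complementation.\<close>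

lemma cyclic_flats_dual:
  "X \<in> cyclic_flats (dual_matroid M) \<longleftrightarrow> X \<subseteq> ground M \<and> ground M - X \<in> cyclic_flats M"
proof (cases "X \<subseteq> ground M")
  case True
  interpret D: matroid "dual_matroid M" by (rule matroid_dual)
  let ?E = "ground M" and ?r = "rank M" and ?r' = "rank (dual_matroid M)"
  have finX: "finite X" using True finite_ground finite_subset by blast
  have r: "?r' X + ?r ?E = card X + ?r (?E - X)" using rank_dual True by simp
  have "?r' (insert e X) \<noteq> ?r' X \<longleftrightarrow> ?r (?E - X - {e}) = ?r (?E - X)" if e: "e \<in> ?E - X" for e
  proof -
    have "?E - insert e X = ?E - X - {e}" by auto
    then have "?r' (insert e X) + ?r ?E = Suc (card X) + ?r (?E - X - {e})"
      using rank_dual[of "insert e X"] e True finX by simp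
    moreover have "?r (?E - X) \<le> Suc (?r (?E - X - {e}))"
      using rank_insert_le[of e "?E - X - {e}"] e by (simp add: insert_absorb)
    moreover have "?r (?E - X - {e}) \<le> ?r (?E - X)" by (intro rank_mono) auto
    ultimately show ?thesis using r by linarith
  qed
  moreover have "?r' (X - {e}) = ?r' X \<longleftrightarrow> ?r (insert e (?E - X)) \<noteq> ?r (?E - X)"
    if e: "e \<in> X" for e
  proof -
    have "?E - (X - {e}) = insert e (?E - X)" using e True by auto
    moreover have "card X = Suc (card (X - {e}))" using card_Suc_Diff1[OF finX e] by simp
    ultimately have "Suc (?r' (X - {e})) + ?r ?E = card X + ?r (insert e (?E - X))"
      using rank_dual[of "X - {e}"] True by (simp add: subset_trans[OF Diff_subset])
    moreover have "?r (insert e (?E - X)) \<le> Suc (?r (?E - X))" by (rule rank_insert_le)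
    moreover have "?r (?E - X) \<le> ?r (insert e (?E - X))" by (intro rank_mono) auto
    ultimately show ?thesis using r by linarith
  qed
  moreover have "?E - (?E - X) = X" using True by auto
  ultimately show ?thesis
    using True unfolding D.cyclic_flats_iff_rank cyclic_flats_iff_rank by auto
qed (auto simp: matroid.cyclic_flats_iff_rank[OF matroid_dual])

end

text \<open>
  The functions \<open>f\<close> and \<open>g\<close> are the coordinates of an embedding into a product of two chains. The
  second clause expresses \<open>B \<le> (A \<and> B) \<or> C\<close> for \<open>A, B, C\<close> from left to right without
  mentioning the lattice operations, which differ between \<open>M\<close>, its dual and its contractions.
\<close>

definition planar_join_distributive ::
    "'a set set \<Rightarrow> ('a set \<Rightarrow> int) \<Rightarrow> ('a set \<Rightarrow> int) \<Rightarrow> bool" where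
  "planar_join_distributive Z f g \<longleftrightarrow>
    (\<forall>X\<in>Z. \<forall>Y\<in>Z. X \<subseteq> Y \<longleftrightarrow> f X \<le> f Y \<and> g X \<le> g Y) \<and>
    (\<forall>A\<in>Z. \<forall>B\<in>Z. \<forall>C\<in>Z. \<forall>F\<in>Z. f A < f B \<longrightarrow> f B < f C \<longrightarrow> g C < g B \<longrightarrow> g B < g A \<longrightarrow>
      C \<subseteq> F \<longrightarrow> (\<forall>G\<in>Z. G \<subseteq> A \<longrightarrow> G \<subseteq> B \<longrightarrow> G \<subseteq> F) \<longrightarrow> B \<subseteq> F)"

lemma planar_join_distributive_subset_iff:
  "planar_join_distributive Z f g \<Longrightarrow> X \<in> Z \<Longrightarrow> Y \<in> Z \<Longrightarrow> X \<subseteq> Y \<longleftrightarrow> f X \<le> f Y \<and> g X \<le> g Y"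
  by (simp add: planar_join_distributive_def)

lemma planar_join_distributiveD:
  assumes "planar_join_distributive Z f g" "A \<in> Z" "B \<in> Z" "C \<in> Z" "F \<in> Z"
    and "f A < f B" "f B < f C" "g C < g B" "g B < g A" "C \<subseteq> F"
    and "\<And>G. G \<in> Z \<Longrightarrow> G \<subseteq> A \<Longrightarrow> G \<subseteq> B \<Longrightarrow> G \<subseteq> F"
  shows "B \<subseteq> F"
  using conjunct2[OF assms(1)[unfolded planar_join_distributive_def], rule_format, OF assms(2-10)]
    assms(11) by blast

text \<open>The condition is pulled back along an order embedding \<open>h\<close> of the cyclic
  flats of the contraction into those of \<open>M\<close>. The map \<open>h\<close> has a lower
  adjoint, which sends \<open>G\<close> to \<open>cl M (G \<union> Y) - Y\<close>; so a common lower
  bound of \<open>h A\<close> and \<open>h B\<close> gives one of \<open>A\<close> and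
  \<open>B\<close>.\<close>

lemma (in matroid) planar_join_distributive_contraction:
  assumes P: "planar_join_distributive (cyclic_flats M) f g" and Y: "Y \<subseteq> ground M"
  shows "\<exists>f g. planar_join_distributive (cyclic_flats (contraction M Y)) f g"
proof -
  let ?Z = "cyclic_flats M" and ?Z' = "cyclic_flats (contraction M Y)" and ?E = "ground M"
  interpret C: matroid "contraction M Y" by (rule matroid_contraction)
  \<comment> \<open>The largest cyclic flat of \<open>M\<close> inside the flat
    \<open>F \<union> Y\<close>.\<close>
  define h where "h F = cf_meet M (F \<union> Y) (F \<union> Y)" for F
  have rank_eq_iff: "rank (contraction M Y) X = rank (contraction M Y) X' \<longleftrightarrow>
      rank M (X \<union> Y) = rank M (X' \<union> Y)" if "X \<subseteq> ?E - Y" "X' \<subseteq> ?E - Y" for X X'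
    using rank_contraction[OF Y that(1)] rank_contraction[OF Y that(2)] by linarith
  have sub: "F \<subseteq> ?E - Y" if "F \<in> ?Z'" for F
    using C.cyclic_flat_subset_ground[OF that] by simp
  have flat: "flat M (F \<union> Y)" if F: "F \<in> ?Z'" for F
  proof -
    have "rank M (insert e (F \<union> Y)) \<noteq> rank M (F \<union> Y)" if e: "e \<in> ?E - (F \<union> Y)" for e
      using F e rank_eq_iff[of "insert e F" F] sub[OF F] by (auto simp: C.cyclic_flats_iff_rank)
    then show ?thesis using sub[OF F] Y by (auto simp: flat_iff_rank)
  qed
  have h_in: "h F \<in> ?Z" if "F \<in> ?Z'" for F
    unfolding h_def by (rule cyclic_part_of_flat[OF flat[OF that]])
  have h_le: "h F \<subseteq> F \<union> Y" for F unfolding h_def by (rule cf_meet_lower)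
  have le_h: "F \<subseteq> h F" if F: "F \<in> ?Z'" for F
  proof
    fix e assume e: "e \<in> F"
    then have "rank M ((F - {e}) \<union> Y) = rank M (F \<union> Y)"
      using F rank_eq_iff[of "F - {e}" F] sub[OF F] by (auto simp: C.cyclic_flats_iff_rank)
    moreover have "(F - {e}) \<union> Y = F \<union> Y - {e}" using e sub[OF F] by auto
    ultimately have "\<exists>C\<in>circuits M. e \<in> C \<and> C \<subseteq> F \<union> Y"
      using e sub[OF F] Y by (subst circuit_through_iff) auto
    then show "e \<in> h F" unfolding h_def cf_meet_def by blast
  qed
  have h_iff: "X \<subseteq> X' \<longleftrightarrow> h X \<subseteq> h X'" if "X \<in> ?Z'" "X' \<in> ?Z'" for X X'
  proof
    assume "X \<subseteq> X'"
    then show "h X \<subseteq> h X'" unfolding h_def cf_meet_def by blast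
  next
    assume "h X \<subseteq> h X'"
    then show "X \<subseteq> X'" using le_h[OF that(1)] h_le[of X'] sub[OF that(1)] by blast
  qed
  \<comment> \<open>The value of the lower adjoint at \<open>G\<close>: the least cyclic flat of the
    contraction whose image under \<open>h\<close> contains \<open>G\<close>.\<close>
  have c_in: "cl M (G \<union> Y) - Y \<in> ?Z'" if G: "G \<in> ?Z" for G
  proof -
    let ?H = "cl M (G \<union> Y)"
    have GY: "G \<union> Y \<subseteq> ?E" using cyclic_flat_subset_ground[OF G] Y by auto
    have H: "G \<union> Y \<subseteq> ?H" "flat M ?H" using subset_cl[OF GY] flat_cl[OF GY] by blast+
    then have HE: "?H \<subseteq> ?E" by (simp add: flat_def)
    have "rank (contraction M Y) (insert e (?H - Y)) \<noteq> rank (contraction M Y) (?H - Y)"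
      if e: "e \<in> ?E - Y - (?H - Y)" for e
    proof -
      have "insert e (?H - Y) \<union> Y = insert e ?H" "?H - Y \<union> Y = ?H" using H by auto
      moreover have "rank M (insert e ?H) \<noteq> rank M ?H" using H e by (auto simp: flat_iff_rank)
      ultimately show ?thesis
        using e HE by (subst rank_eq_iff) auto
    qed
    moreover have "rank (contraction M Y) (?H - Y - {e}) = rank (contraction M Y) (?H - Y)"
      if e: "e \<in> ?H - Y" for e
    proof -
      have "rank M (insert e (G \<union> Y - {e})) = rank M (G \<union> Y - {e})"
      proof (cases "e \<in> G")
        case True
        then have "rank M (insert e (G - {e})) = rank M (G - {e})"
          using G by (simp add: cyclic_flats_iff_rank insert_absorb)
        then show ?thesis by (rule rank_insert_mono[rotated]) auto
      next
        case False
        then have "G \<union> Y - {e} = G \<union> Y" using e by auto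
        then show ?thesis using e by (simp add: cl_def)
      qed
      then have "rank M (insert e (?H - {e})) = rank M (?H - {e})"
        by (rule rank_insert_mono[rotated]) (use H in auto)
      then have "rank M (?H - {e}) = rank M ?H" using e by (simp add: insert_absorb)
      moreover have "?H - Y - {e} \<union> Y = ?H - {e}" "?H - Y \<union> Y = ?H" using H e by auto
      ultimately show ?thesis using HE by (subst rank_eq_iff) auto
    qed
    ultimately show ?thesis using HE by (auto simp: C.cyclic_flats_iff_rank)
  qed
  have "planar_join_distributive ?Z' (f \<circ> h) (g \<circ> h)"
    unfolding planar_join_distributive_def o_def
  proof (intro conjI ballI impI)
    fix X X' assume "X \<in> ?Z'" "X' \<in> ?Z'"
    then show "X \<subseteq> X' \<longleftrightarrow> f (h X) \<le> f (h X') \<and> g (h X) \<le> g (h X')"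
      using P h_in h_iff by (simp add: planar_join_distributive_def)
  next
    fix A B C F
    assume Z: "A \<in> ?Z'" "B \<in> ?Z'" "C \<in> ?Z'" "F \<in> ?Z'"
      and lr: "f (h A) < f (h B)" "f (h B) < f (h C)" "g (h C) < g (h B)" "g (h B) < g (h A)"
      and "C \<subseteq> F" and low: "\<forall>G\<in>?Z'. G \<subseteq> A \<longrightarrow> G \<subseteq> B \<longrightarrow> G \<subseteq> F"
    have "G \<subseteq> h F" if G: "G \<in> ?Z" "G \<subseteq> h A" "G \<subseteq> h B" for G
    proof -
      have GE: "G \<union> Y \<subseteq> ?E" using cyclic_flat_subset_ground[OF G(1)] Y by auto
      have c_le: "cl M (G \<union> Y) - Y \<subseteq> X" if "X \<in> ?Z'" "G \<subseteq> h X" for X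
        using cl_mono[of "G \<union> Y" "X \<union> Y"] flat[OF that(1)] h_le[of X] that(2)
        by (auto simp: flat_def)
      have "cl M (G \<union> Y) - Y \<subseteq> F"
        using low c_in[OF G(1)] c_le[OF Z(1) G(2)] c_le[OF Z(2) G(3)] by simp
      then have "G \<subseteq> F \<union> Y" using subset_cl[OF GE] by blast
      then show ?thesis unfolding h_def using G(1) by (intro cf_meet_greatest)
    qed
    moreover have "h C \<subseteq> h F" using h_iff Z \<open>C \<subseteq> F\<close> by simp
    ultimately have "h B \<subseteq> h F"
      using planar_join_distributiveD[OF P, of "h A" "h B" "h C" "h F"] lr h_in Z by simp
    then show "B \<subseteq> F" using h_iff Z by simp
  qed
  then show ?thesis by blast
qed

section \<open>Transversal presentations\<close>

text \<open>A minimal element occurs only in its own sum, so its value can be fixed after all the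
  others.\<close>

lemma moebius_inversion_above:
  fixes w :: "'b::order \<Rightarrow> 'c::ab_group_add"
  assumes "finite Z"
  shows "\<exists>\<beta>. \<forall>x\<in>Z. (\<Sum>y\<in>{y\<in>Z. x \<le> y}. \<beta> y) = w x"
  using assms
proof (induction "card Z" arbitrary: Z)
  case 0
  then show ?case by simp
next
  case (Suc n)
  then have "Z \<noteq> {}" by auto
  then obtain m where m: "m \<in> Z" "\<And>x. x \<in> Z \<Longrightarrow> x \<le> m \<Longrightarrow> m = x"
    using finite_has_minimal[OF Suc.prems] by metis
  let ?Z = "Z - {m}"
  have "n = card ?Z" using Suc.hyps(2) m Suc.prems by simp
  then obtain \<beta> where \<beta>: "\<forall>x\<in>?Z. (\<Sum>y\<in>{y\<in>?Z. x \<le> y}. \<beta> y) = w x"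
    using Suc.hyps(1)[of ?Z] Suc.prems by blast
  let ?\<beta> = "\<beta>(m := w m - (\<Sum>y\<in>{y\<in>?Z. m \<le> y}. \<beta> y))"
  have eq: "(\<Sum>y\<in>{y\<in>?Z. x \<le> y}. ?\<beta> y) = (\<Sum>y\<in>{y\<in>?Z. x \<le> y}. \<beta> y)" for x
    by (rule sum.cong) auto
  have "(\<Sum>y\<in>{y\<in>Z. x \<le> y}. ?\<beta> y) = w x" if x: "x \<in> Z" for x
  proof (cases "x = m")
    case True
    have "{y\<in>Z. m \<le> y} = insert m {y\<in>?Z. m \<le> y}" using m by auto
    then have "(\<Sum>y\<in>{y\<in>Z. m \<le> y}. ?\<beta> y) = ?\<beta> m + (\<Sum>y\<in>{y\<in>?Z. m \<le> y}. ?\<beta> y)"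
      using Suc.prems by simp
    then show ?thesis unfolding eq using True by simp
  next
    case False
    then have "{y\<in>Z. x \<le> y} = {y\<in>?Z. x \<le> y}" using m(2) x by auto
    then have "(\<Sum>y\<in>{y\<in>Z. x \<le> y}. ?\<beta> y) = (\<Sum>y\<in>{y\<in>?Z. x \<le> y}. ?\<beta> y)" by simp
    then show ?thesis unfolding eq using \<beta> x False by simp
  qed
  then show ?case by (intro exI[of _ ?\<beta>]) blast
qed

text \<open>\<open>transversal\<close> wants indices below some natural number, while the
  presentation constructed later is indexed by pairs of a cyclic flat and a copy number.\<close>

lemma transversalI_finite_index:
  assumes "finite K" "\<And>k. k \<in> K \<Longrightarrow> A k \<subseteq> ground M"
    and "\<And>I. I \<in> indep M \<longleftrightarrow> (\<exists>\<phi>. inj_on \<phi> I \<and> (\<forall>e\<in>I. \<phi> e \<in> K \<and> e \<in> A (\<phi> e)))"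
  shows "transversal M"
proof -
  obtain b where b: "bij_betw b {..<card K} K"
    using ex_bij_betw_nat_finite[OF assms(1)] by (auto simp: lessThan_atLeast0)
  let ?b' = "inv_into {..<card K} b"
  have b': "?b' k < card K" "b (?b' k) = k" if "k \<in> K" for k
    using b that inv_into_into[of k b "{..<card K}"] f_inv_into_f[of k b "{..<card K}"]
    by (auto simp: bij_betw_def)
  have "I \<in> indep M \<longleftrightarrow> partial_transversal (card K) (A \<circ> b) I" for I
  proof
    assume "I \<in> indep M"
    then obtain \<phi> where \<phi>: "inj_on \<phi> I" "\<And>e. e \<in> I \<Longrightarrow> \<phi> e \<in> K \<and> e \<in> A (\<phi> e)"
      using assms(3) by blast
    have "inj_on (?b' \<circ> \<phi>) I"
    proof (rule inj_onI)
      fix x y assume "x \<in> I" "y \<in> I" "(?b' \<circ> \<phi>) x = (?b' \<circ> \<phi>) y"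
      then have "b (?b' (\<phi> x)) = b (?b' (\<phi> y))" by simp
      then have "\<phi> x = \<phi> y" using b'(2) \<phi>(2) \<open>x \<in> I\<close> \<open>y \<in> I\<close> by simp
      then show "x = y" using \<phi>(1) \<open>x \<in> I\<close> \<open>y \<in> I\<close> by (simp add: inj_on_eq_iff)
    qed
    then show "partial_transversal (card K) (A \<circ> b) I"
      unfolding partial_transversal_def using b' \<phi>(2) by (intro exI[of _ "?b' \<circ> \<phi>"]) auto
  next
    assume "partial_transversal (card K) (A \<circ> b) I"
    then obtain \<phi> where \<phi>: "inj_on \<phi> I" "\<forall>e\<in>I. \<phi> e < card K \<and> e \<in> A (b (\<phi> e))"
      unfolding partial_transversal_def by auto
    have "inj_on b (\<phi> ` I)" using b \<phi>(2) by (auto simp: bij_betw_def intro: inj_on_subset)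
    then have "inj_on (b \<circ> \<phi>) I" using \<phi>(1) comp_inj_on by blast
    moreover have "\<forall>e\<in>I. (b \<circ> \<phi>) e \<in> K \<and> e \<in> A ((b \<circ> \<phi>) e)"
      using \<phi>(2) b by (auto simp: bij_betw_def)
    ultimately show "I \<in> indep M" using assms(3) by blast
  qed
  moreover have "\<forall>j<card K. (A \<circ> b) j \<subseteq> ground M"
    using assms(2) b by (auto simp: bij_betw_def)
  ultimately show ?thesis unfolding transversal_def
    by (intro exI[of _ "card K"] exI[of _ "A \<circ> b"]) auto
qed

text \<open>Intersect the sets of a presentation with \<open>S\<close>.\<close>

lemma transversal_restriction:
  assumes "transversal M"
  shows "transversal (restriction M S)"
proof -
  obtain n A where A: "\<forall>j<n. A j \<subseteq> ground M" "indep M = {I. partial_transversal n A I}"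
    using assms unfolding transversal_def by blast
  have "indep (restriction M S) = {I. partial_transversal n (\<lambda>j. A j \<inter> S) I}"
    using A(2) by (auto simp: restriction_def partial_transversal_def)
  then show ?thesis
    unfolding transversal_def using A(1)
    by (intro exI[of _ n] exI[of _ "\<lambda>j. A j \<inter> S"]) auto
qed

section \<open>The presentation by complements of cyclic flats\<close>

context matroid
begin

text \<open>
  In a planar lattice the inclusion-exclusion sum over the filter generated by an antichain
  collapses to \<open>\<Sum>i. r (A i) - \<Sum>i. r (A i \<union> A (i + 1))\<close>, the members being listed from left to
  right, and the induction removes the rightmost one.
\<close>

lemma filter_sum_le:
  fixes \<beta> :: "'a set \<Rightarrow> int"
  assumes P: "planar_join_distributive (cyclic_flats M) f g"
    and \<beta>: "\<And>X. X \<in> cyclic_flats M \<Longrightarrow>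
      (\<Sum>Y\<in>{Y\<in>cyclic_flats M. X \<subseteq> Y}. \<beta> Y) = int (rank M (ground M)) - int (rank M X)"
    and "T \<subseteq> cyclic_flats M" "T \<noteq> {}"
  shows "(\<Sum>Y\<in>{Y\<in>cyclic_flats M. \<exists>A\<in>T. A \<subseteq> Y}. \<beta> Y) \<le>
    int (rank M (ground M)) - int (rank M (\<Inter>T))"
  using assms(3,4)
proof (induction "card T" arbitrary: T rule: less_induct)
  case less
  let ?Z = "cyclic_flats M"
  define U where "U T = {Y\<in>?Z. \<exists>A\<in>T. A \<subseteq> Y}" for T
  note le_iff = planar_join_distributive_subset_iff[OF P]
  have finT: "finite T" using less.prems finite_cyclic_flats finite_subset by blast
  have finU: "finite (U T)" for T using finite_cyclic_flats by (simp add: U_def)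
  show ?case
  proof (cases "\<exists>A\<in>T. \<exists>B\<in>T. A \<subset> B")
    case True
    then obtain A B where AB: "A \<in> T" "B \<in> T" "A \<subset> B" by blast
    \<comment> \<open>Dropping a non-minimal member changes neither the filter nor the
      intersection.\<close>
    have "U (T - {B}) = U T" "\<Inter>(T - {B}) = \<Inter>T" using AB by (auto simp: U_def)
    moreover have "card (T - {B}) < card T" using finT AB by (intro card_Diff1_less)
    moreover have "T - {B} \<noteq> {}" using AB by blast
    moreover have "T - {B} \<subseteq> ?Z" using less.prems by blast
    ultimately show ?thesis using less.hyps[of "T - {B}"] by (simp add: U_def)
  next
    case antichain: False
    \<comment> \<open>On an antichain \<open>g\<close> strictly decreases as \<open>f\<close>
      increases; this is the order from left to right.\<close>
    have f_inj: "g Y < g X" if "X \<in> T" "Y \<in> T" "f X \<le> f Y" "X \<noteq> Y" for X Y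
    proof -
      have "X \<in> ?Z" "Y \<in> ?Z" "\<not> X \<subseteq> Y" using less.prems(1) that antichain by blast+
      then show ?thesis using le_iff[of X Y] that(3) by simp
    qed
    have f_strict: "f X < f Y" if "X \<in> T" "Y \<in> T" "f X \<le> f Y" "X \<noteq> Y" for X Y
      using f_inj[of X Y] f_inj[of Y X] that by force
    obtain C where C: "C \<in> T" "\<And>X. X \<in> T \<Longrightarrow> f X \<le> f C"
      using obtains_MAX[OF finT less.prems(2), of f] Max_ge[of "f ` T"] finT by (metis finite_imageI imageI)
    let ?T = "T - {C}"
    show ?thesis
    proof (cases "?T = {}")
      case True
      then have "T = {C}" using C by auto
      then show ?thesis using \<beta>[of C] less.prems by simp
    next
      case False
      have finT': "finite ?T" using finT by simp
      \<comment> \<open>\<open>C\<close> is rightmost, \<open>B\<close> is its left neighbour, and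
        \<open>A\<close> is the leftmost member; \<open>A = B\<close> if only one member besides
        \<open>C\<close> is left.\<close>
      obtain B where B: "B \<in> ?T" "\<And>X. X \<in> ?T \<Longrightarrow> f X \<le> f B"
        using obtains_MAX[OF finT' False, of f] Max_ge[of "f ` ?T"] finT'
        by (metis finite_imageI imageI)
      obtain A where A: "A \<in> ?T" "\<And>X. X \<in> ?T \<Longrightarrow> f A \<le> f X"
        using obtains_MIN[OF finT' False, of f] Min_le[of "f ` ?T"] finT'
        by (metis finite_imageI imageI)
      have Z: "A \<in> ?Z" "B \<in> ?Z" "C \<in> ?Z" using A B C less.prems by auto
      have BC: "f B < f C" "g C < g B"
        using f_strict[of B C] f_inj[of B C] B C by auto
      let ?J = "cf_join M B C"
      have JZ: "?J \<in> ?Z" using cf_join_cyclic_flat Z by blast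
      have split: "U T = U ?T \<union> {Y\<in>?Z. C \<subseteq> Y}" using C by (auto simp: U_def)
      \<comment> \<open>Planarity: whatever lies above \<open>C\<close> and above some member to its
        left has both coordinates at least those of \<open>B\<close>, so it lies above the join of
        \<open>B\<close> and \<open>C\<close>.\<close>
      have int: "U ?T \<inter> {Y\<in>?Z. C \<subseteq> Y} = {Y\<in>?Z. ?J \<subseteq> Y}"
      proof (intro equalityI subsetI)
        fix Y assume "Y \<in> U ?T \<inter> {Y\<in>?Z. C \<subseteq> Y}"
        then obtain X where X: "Y \<in> ?Z" "C \<subseteq> Y" "X \<in> ?T" "X \<subseteq> Y" by (auto simp: U_def)
        have "g B \<le> g X" using f_inj[of X B] X(3) B by (cases "X = B") auto
        moreover have "g X \<le> g Y" "f C \<le> f Y" using le_iff X less.prems Z by auto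
        ultimately have "B \<subseteq> Y" using le_iff[of B Y] Z X BC by auto
        then show "Y \<in> {Y\<in>?Z. ?J \<subseteq> Y}" using X cf_join_least by auto
      next
        fix Y assume "Y \<in> {Y\<in>?Z. ?J \<subseteq> Y}"
        then show "Y \<in> U ?T \<inter> {Y\<in>?Z. C \<subseteq> Y}"
          using cf_join_upper[OF Z(2,3)] B(1) unfolding U_def by blast
      qed
      have "(\<Sum>Y\<in>U T. \<beta> Y) =
          (\<Sum>Y\<in>U ?T. \<beta> Y) + (\<Sum>Y\<in>{Y\<in>?Z. C \<subseteq> Y}. \<beta> Y) - (\<Sum>Y\<in>{Y\<in>?Z. ?J \<subseteq> Y}. \<beta> Y)"
        unfolding split int[symmetric] using finU finite_cyclic_flats by (intro sum_Un) auto
      also have "\<dots> \<le> int (rank M (ground M)) - int (rank M (\<Inter>?T))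
          - int (rank M C) + int (rank M ?J)"
      proof -
        have "(\<Sum>Y\<in>U ?T. \<beta> Y) \<le> int (rank M (ground M)) - int (rank M (\<Inter>?T))"
          unfolding U_def using finT C False less.prems by (intro less.hyps card_Diff1_less) auto
        then show ?thesis using \<beta>[OF Z(3)] \<beta>[OF JZ] by linarith
      qed
      \<comment> \<open>This amounts to \<open>rank M (\<Inter>T) + rank M ?J \<le> rank M
        (\<Inter>?T) + rank M C\<close>. It follows from submodularity once the rank of
        \<open>?J\<close> is bounded by that of \<open>\<Inter>?T \<union> C\<close>.\<close>
      also have "\<dots> \<le> int (rank M (ground M)) - int (rank M (\<Inter>T))"
      proof -
        let ?L = "cf_meet M A B"
        have LZ: "?L \<in> ?Z" using cf_meet_cyclic_flat Z by blast
        \<comment> \<open>The meet of the two outermost members lies below all members between them,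
          by their coordinates.\<close>
        have L: "?L \<subseteq> \<Inter>?T"
        proof (rule Inter_greatest)
          fix X assume X: "X \<in> ?T"
          have "g B \<le> g X" using f_inj[of X B] X B by (cases "X = B") auto
          moreover have "f A \<le> f X" using A X by blast
          moreover have "f ?L \<le> f A" "g ?L \<le> g B"
            using le_iff[OF LZ Z(1)] le_iff[OF LZ Z(2)] cf_meet_lower by auto
          ultimately show "?L \<subseteq> X" using le_iff[OF LZ, of X] X less.prems by auto
        qed
        let ?F = "cf_join M ?L C"
        have FZ: "?F \<in> ?Z" using cf_join_cyclic_flat LZ Z by blast
        \<comment> \<open>The only use of the distributivity condition, for the leftmost member,
          \<open>B\<close> and \<open>C\<close>.\<close>
        have "B \<subseteq> ?F"
        proof (cases "A = B")
          case True
          then show ?thesis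
            using cf_join_upper(1)[OF LZ Z(3)] cf_meet_greatest[OF Z(2), of A B] by auto
        next
          case False
          show ?thesis
          proof (rule planar_join_distributiveD[OF P Z(1,2,3) FZ _ BC])
            show "f A < f B" "g B < g A"
              using f_strict[of A B] f_inj[of A B] A B False by auto
            show "C \<subseteq> ?F" using cf_join_upper(2)[OF LZ Z(3)] .
            fix G assume "G \<in> ?Z" "G \<subseteq> A" "G \<subseteq> B"
            then show "G \<subseteq> ?F" using cf_meet_greatest cf_join_upper(1)[OF LZ Z(3)] by blast
          qed
        qed
        then have "?J \<subseteq> ?F" using cf_join_least[OF FZ] cf_join_upper(2)[OF LZ Z(3)] by blast
        then have "rank M ?J \<le> rank M ?F" by (rule rank_mono)
        also have "\<dots> = rank M (?L \<union> C)"
          unfolding cf_join_def using LZ Z cyclic_flat_subset_ground by (intro rank_cl) auto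
        also have "\<dots> \<le> rank M (\<Inter>?T \<union> C)" using L by (intro rank_mono) auto
        finally have "rank M ?J \<le> rank M (\<Inter>?T \<union> C)" .
        moreover have "\<Inter>?T \<inter> C = \<Inter>T" using C by auto
        ultimately show ?thesis using rank_submodular[of "\<Inter>?T" C] by simp
      qed
      finally show ?thesis by (simp add: U_def)
    qed
  qed
qed

lemma planar_join_distributive_transversal:
  assumes P: "planar_join_distributive (cyclic_flats M) f g"
  shows "transversal M"
proof -
  let ?Z = "cyclic_flats M" and ?E = "ground M" and ?r = "\<lambda>X. int (rank M X)"
  have finZ: "finite ?Z" by (rule finite_cyclic_flats)
  obtain \<beta> :: "'a set \<Rightarrow> int"
    where \<beta>: "\<And>X. X \<in> ?Z \<Longrightarrow> (\<Sum>Y\<in>{Y\<in>?Z. X \<subseteq> Y}. \<beta> Y) = ?r ?E - ?r X"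
    using moebius_inversion_above[OF finZ, of "\<lambda>X. ?r ?E - ?r X"] by blast
  note sum_le = filter_sum_le[OF P \<beta>]
  \<comment> \<open>The filter bound for the cyclic flats strictly above \<open>X\<close>, whose
    intersection contains \<open>X\<close>.\<close>
  have nonneg: "0 \<le> \<beta> X" if X: "X \<in> ?Z" for X
  proof -
    let ?T = "{Y\<in>?Z. X \<subset> Y}"
    have "{Y\<in>?Z. X \<subseteq> Y} = insert X ?T" using X by auto
    then have "(\<Sum>Y\<in>{Y\<in>?Z. X \<subseteq> Y}. \<beta> Y) = \<beta> X + (\<Sum>Y\<in>?T. \<beta> Y)" using finZ by simp
    then have eq: "\<beta> X = ?r ?E - ?r X - (\<Sum>Y\<in>?T. \<beta> Y)" using \<beta>[OF X] by linarith
    show ?thesis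
    proof (cases "?T = {}")
      case True
      have "rank M X \<le> rank M ?E" using cyclic_flat_subset_ground[OF X] by (rule rank_mono)
      then show ?thesis using eq unfolding True by simp
    next
      case False
      have "{Y\<in>?Z. \<exists>A\<in>?T. A \<subseteq> Y} = ?T" by auto
      then have "(\<Sum>Y\<in>?T. \<beta> Y) \<le> ?r ?E - ?r (\<Inter>?T)" using sum_le[of ?T] False by auto
      moreover have "rank M X \<le> rank M (\<Inter>?T)" by (rule rank_mono) auto
      ultimately show ?thesis using eq by linarith
    qed
  qed
  \<comment> \<open>The index set has \<open>\<beta> F\<close> copies of each cyclic flat
    \<open>F\<close>; \<open>nat\<close> loses nothing by \<open>nonneg\<close>.\<close>
  define K where "K = Sigma ?Z (\<lambda>F. {..<nat (\<beta> F)})"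
  have finK: "finite K" using finZ by (simp add: K_def)
  have card_K: "int (card {k\<in>K. Q (fst k)}) = (\<Sum>F\<in>{F\<in>?Z. Q F}. \<beta> F)" for Q
  proof -
    have "{k\<in>K. Q (fst k)} = Sigma {F\<in>?Z. Q F} (\<lambda>F. {..<nat (\<beta> F)})" by (auto simp: K_def)
    then have "card {k\<in>K. Q (fst k)} = (\<Sum>F\<in>{F\<in>?Z. Q F}. nat (\<beta> F))" using finZ by simp
    then show ?thesis using nonneg by simp
  qed
  have K_total: "int (card K) = ?r ?E"
  proof -
    \<comment> \<open>The closure of the empty set is the least cyclic flat and has rank 0, so its
      filter sum is the total of \<open>\<beta>\<close>.\<close>
    have L: "cl M {} \<in> ?Z" by (rule cl_cyclic_flat) auto
    have "{F\<in>?Z. cl M {} \<subseteq> F} = ?Z" using cl_subset_cyclic_flat by auto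
    moreover have "rank M (cl M {}) = 0" using rank_cl[of "{}"] rank_indep[OF empty_indep] by simp
    ultimately have "(\<Sum>F\<in>?Z. \<beta> F) = ?r ?E" using \<beta>[OF L] by simp
    then show ?thesis using card_K[of "\<lambda>_. True"] by simp
  qed
  \<comment> \<open>\<open>X\<close> meets the complement of \<open>F\<close> iff \<open>X\<close>
    is not contained in \<open>F\<close>, so this counts the sets of the presentation that meet
    \<open>X\<close>.\<close>
  have card_meeting: "int (card {k\<in>K. \<not> X \<subseteq> fst k}) = ?r ?E - (\<Sum>F\<in>{F\<in>?Z. X \<subseteq> F}. \<beta> F)" for X
  proof -
    have "card K = card ({k\<in>K. X \<subseteq> fst k} \<union> {k\<in>K. \<not> X \<subseteq> fst k})"
      by (rule arg_cong[of _ _ card]) auto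
    also have "\<dots> = card {k\<in>K. X \<subseteq> fst k} + card {k\<in>K. \<not> X \<subseteq> fst k}"
      using finK by (intro card_Un_disjoint) auto
    finally show ?thesis using K_total card_K[of "\<lambda>F. X \<subseteq> F"] by linarith
  qed
  show ?thesis
  proof (rule transversalI_finite_index[OF finK, of "\<lambda>k. ?E - fst k"])
    fix I
    show "I \<in> indep M \<longleftrightarrow> (\<exists>\<phi>. inj_on \<phi> I \<and> (\<forall>e\<in>I. \<phi> e \<in> K \<and> e \<in> ?E - fst (\<phi> e)))"
    proof
      assume I: "I \<in> indep M"
      have "\<exists>\<phi>. inj_on \<phi> I \<and> (\<forall>e\<in>I. \<phi> e \<in> {k\<in>K. e \<notin> fst k})"
      proof (rule hall)
        fix J assume J: "J \<subseteq> I"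
        then have JI: "J \<in> indep M" using I indep_hereditary by blast
        let ?T = "{F\<in>?Z. J \<subseteq> F}"
        have "(\<Sum>F\<in>?T. \<beta> F) \<le> ?r ?E - ?r J"
        proof (cases "?T = {}")
          \<comment> \<open>The filter bound needs a nonempty family; the empty sum is bounded by
            monotonicity of rank.\<close>
          case True
          have "rank M J \<le> rank M ?E" using indep_subset_ground[OF JI] by (rule rank_mono)
          then show ?thesis unfolding True by simp
        next
          case False
          have "{Y\<in>?Z. \<exists>A\<in>?T. A \<subseteq> Y} = ?T" by auto
          then have "(\<Sum>F\<in>?T. \<beta> F) \<le> ?r ?E - ?r (\<Inter>?T)" using sum_le[of ?T] False by auto
          moreover have "rank M J \<le> rank M (\<Inter>?T)" by (rule rank_mono) auto
          ultimately show ?thesis by linarith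
        qed
        then have "card J \<le> card {k\<in>K. \<not> J \<subseteq> fst k}"
          using card_meeting[of J] rank_indep[OF JI] by linarith
        also have "{k\<in>K. \<not> J \<subseteq> fst k} = (\<Union>e\<in>J. {k\<in>K. e \<notin> fst k})" by auto
        finally show "card J \<le> card (\<Union>e\<in>J. {k\<in>K. e \<notin> fst k})" .
      qed (use finK finite_indep[OF I] in auto)
      then show "\<exists>\<phi>. inj_on \<phi> I \<and> (\<forall>e\<in>I. \<phi> e \<in> K \<and> e \<in> ?E - fst (\<phi> e))"
        using indep_subset_ground[OF I] by blast
    next
      assume "\<exists>\<phi>. inj_on \<phi> I \<and> (\<forall>e\<in>I. \<phi> e \<in> K \<and> e \<in> ?E - fst (\<phi> e))"
      then obtain \<phi> where \<phi>: "inj_on \<phi> I" "\<forall>e\<in>I. \<phi> e \<in> K \<and> e \<in> ?E - fst (\<phi> e)" by blast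
      then have IE: "I \<subseteq> ?E" by auto
      show "I \<in> indep M"
      proof (rule ccontr)
        assume "I \<notin> indep M"
        then obtain C where C: "C \<in> circuits M" "C \<subseteq> I" using circuit_in_dependent IE by blast
        have CE: "C \<subseteq> ?E" using C IE by blast
        have finC: "finite C" using CE finite_ground finite_subset by blast
        have XZ: "cl M C \<in> ?Z"
          using CE circuit_through_iff[of _ C] C(1) by (intro cl_cyclic_flat) blast+
        \<comment> \<open>The closure of the circuit is a cyclic flat, so its filter sum is known
          exactly: only \<open>rank M C\<close> sets of the presentation meet \<open>C\<close>, too
          few to match it.\<close>
        have "{F\<in>?Z. C \<subseteq> F} = {F\<in>?Z. cl M C \<subseteq> F}"
          using cl_subset_cyclic_flat subset_cl[OF CE] by blast
        then have "int (card {k\<in>K. \<not> C \<subseteq> fst k}) = ?r C"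
          using card_meeting[of C] \<beta>[OF XZ] rank_cl[OF CE] by simp
        moreover have "card C \<le> card {k\<in>K. \<not> C \<subseteq> fst k}"
        proof (rule card_inj_on_le[of \<phi>])
          show "inj_on \<phi> C" using \<phi>(1) C(2) by (rule inj_on_subset)
          show "\<phi> ` C \<subseteq> {k\<in>K. \<not> C \<subseteq> fst k}" using \<phi>(2) C(2) by blast
        qed (use finK in auto)
        moreover have "rank M C < card C"
        proof -
          obtain D where D: "D \<in> indep M" "D \<subseteq> C" "card D = rank M C"
            using rank_attained by blast
          then have "D \<subset> C" using C(1) by (auto simp: circuits_def)
          then show ?thesis using D finC psubset_card_mono by metis
        qed
        ultimately show False by linarith
      qed
    qed
  qed auto
qed

end

text \<open>The condition has been carried over to contractions only, so the induction represents
  each minor as a restriction of a matroid with the condition. Deletions shrink the restriction,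
  contractions move inside it, and transversality is restricted at the end.\<close>

lemma minor_transversal:
  assumes "matroid M" "planar_join_distributive (cyclic_flats M) f g" "minor M N"
  shows "transversal N"
proof -
  have "\<exists>M' S f g. matroid M' \<and> planar_join_distributive (cyclic_flats M') f g \<and>
      N = restriction M' S"
    using assms(3)
  proof induction
    case minor_refl
    have "M = restriction M (ground M)"
      using matroid.indep_subset_ground[OF assms(1)]
      by (intro set_system.equality) (auto simp: restriction_def)
    then show ?case using assms by blast
  next
    case (minor_deletion N X)
    then show ?case unfolding deletion_def by (metis restriction_restriction)
  next
    case (minor_contraction N X)
    then obtain M' S f g where M': "matroid M'"
      "planar_join_distributive (cyclic_flats M') f g" "N = restriction M' S" by blast
    have X: "X \<subseteq> ground M' \<inter> S" using minor_contraction.hyps(2) M'(3) by simp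
    then have "X \<subseteq> ground M'" by blast
    then obtain f g where "planar_join_distributive (cyclic_flats (contraction M' X)) f g"
      using matroid.planar_join_distributive_contraction[OF M'(1,2)] by blast
    then show ?case
      using matroid.contraction_restriction[OF M'(1) X] matroid.matroid_contraction[OF M'(1)] M'(3)
      by blast
  qed
  then show ?thesis
    using matroid.planar_join_distributive_transversal transversal_restriction by blast
qed

section \<open>From dimension two and distributive antichains\<close>

lemma planar_coordinates:
  fixes P :: "'b::order set"
  assumes "order_dim P \<le> 2" "finite P"
  obtains f g :: "'b \<Rightarrow> int" where "\<And>x y. x \<in> P \<Longrightarrow> y \<in> P \<Longrightarrow> x \<le> y \<longleftrightarrow> f x \<le> f y \<and> g x \<le> g y"
proof -
  let ?A = "{enat n | n. embeds_in_chain_product n P}"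
  \<comment> \<open>The empty set would have infimum \<open>\<infinity>\<close>; a nonempty one
    attains its infimum, which yields an actual number of at most two chains.\<close>
  have "?A \<noteq> {}"
  proof
    assume "?A = {}"
    then have "order_dim P = \<infinity>" unfolding order_dim_def by (simp add: Inf_enat_def)
    then show False using assms(1) by (simp add: numeral_eq_enat)
  qed
  then have "order_dim P \<in> ?A" unfolding order_dim_def by (auto simp: Inf_enat_def intro: LeastI)
  then obtain n where n: "n \<le> 2" "embeds_in_chain_product n P"
    using assms(1) by (auto simp: numeral_eq_enat)
  from n(2)[unfolded embeds_in_chain_product_def] obtain C :: "nat \<Rightarrow> 'b set" and r F where
    lin: "\<forall>i<n. linear_order_on (C i) (r i)" and F: "F \<in> P \<rightarrow> PiE {..<n} C" and
    le: "\<forall>x\<in>P. \<forall>y\<in>P. x \<le> y \<longleftrightarrow> (\<forall>i<n. (F x i, F y i) \<in> r i)"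
    by (elim exE conjE) (rule that)
  \<comment> \<open>The height in chain \<open>i\<close>, counted by the members of \<open>P\<close>
    weakly below \<open>x\<close>. Missing chains are replaced by the constant 0, so there are
    always two coordinates.\<close>
  define h where "h i x = (if i < n then int (card {z\<in>P. (F z i, F x i) \<in> r i}) else 0)" for i x
  have h: "(F x i, F y i) \<in> r i \<longleftrightarrow> h i x \<le> h i y" if i: "i < n" and xy: "x \<in> P" "y \<in> P" for i x y
  proof
    have ord: "refl_on (C i) (r i)" "trans (r i)" "antisym (r i)" "total_on (C i) (r i)"
      using lin i by (auto simp: order_on_defs)
    have FC: "F z i \<in> C i" if "z \<in> P" for z using F that i by auto
    {
      assume "(F x i, F y i) \<in> r i"
      then have "{z\<in>P. (F z i, F x i) \<in> r i} \<subseteq> {z\<in>P. (F z i, F y i) \<in> r i}"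
        using ord(2) by (auto dest: transD)
      then show "h i x \<le> h i y" using i assms(2) by (auto simp: h_def intro: card_mono)
    next
      assume le: "h i x \<le> h i y"
      show "(F x i, F y i) \<in> r i"
      proof (rule ccontr)
        assume no: "(F x i, F y i) \<notin> r i"
        have refl: "(F x i, F x i) \<in> r i" using ord(1) FC xy by (auto dest: refl_onD)
        have yx: "(F y i, F x i) \<in> r i"
          using ord(4) FC xy no refl by (metis total_on_def)
        have "{z\<in>P. (F z i, F y i) \<in> r i} \<subset> {z\<in>P. (F z i, F x i) \<in> r i}"
          using yx no refl xy ord(2) by (auto dest: transD)
        then have "h i y < h i x" using i assms(2) by (auto simp: h_def intro: psubset_card_mono)
        then show False using le by simp
      qed
    }
  qed
  have "x \<le> y \<longleftrightarrow> h 0 x \<le> h 0 y \<and> h 1 x \<le> h 1 y" if xy: "x \<in> P" "y \<in> P" for x y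
  proof -
    have "x \<le> y \<longleftrightarrow> (\<forall>i<n. h i x \<le> h i y)" using le h xy by blast
    also have "\<dots> \<longleftrightarrow> (\<forall>i<2. h i x \<le> h i y)" using n(1) by (auto simp: h_def)
    also have "\<dots> \<longleftrightarrow> h 0 x \<le> h 0 y \<and> h 1 x \<le> h 1 y" by (auto simp: less_2_cases_iff)
    finally show ?thesis .
  qed
  then show thesis by (rule that)
qed

theorem theorem3p1:
  fixes M :: "'a set_system"
  assumes "matroid M"
    and "order_dim (cyclic_flats M) \<le> 2"
    and "\<And>S. S \<subseteq> cyclic_flats M \<Longrightarrow> antichain S \<Longrightarrow> cf_distributive M (cf_sublattice M S)"
  shows "\<forall>N. minor M N \<longrightarrow> transversal N \<and> transversal (dual_matroid N)"
proof -
  interpret matroid M by (rule assms(1))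
  let ?Z = "cyclic_flats M" and ?E = "ground M"
  obtain f g :: "'a set \<Rightarrow> int"
    where le_iff: "\<And>X Y. X \<in> ?Z \<Longrightarrow> Y \<in> ?Z \<Longrightarrow> X \<subseteq> Y \<longleftrightarrow> f X \<le> f Y \<and> g X \<le> g Y"
    using planar_coordinates[OF assms(2) finite_cyclic_flats] by blast
  \<comment> \<open>Strictly opposite coordinates make \<open>A\<close>, \<open>B\<close>,
    \<open>C\<close> an antichain; the distributive law is needed only for its generators.\<close>
  have distrib: "cf_meet M X (cf_join M Y W) = cf_join M (cf_meet M X Y) (cf_meet M X W)"
    if lr: "f A < f B" "f B < f C" "g C < g B" "g B < g A" and Z: "A \<in> ?Z" "B \<in> ?Z" "C \<in> ?Z"
      and S: "X \<in> {A, B, C}" "Y \<in> {A, B, C}" "W \<in> {A, B, C}" for A B C X Y W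
  proof -
    have "\<not> A \<subseteq> B" "\<not> B \<subseteq> A" "\<not> A \<subseteq> C" "\<not> C \<subseteq> A" "\<not> B \<subseteq> C" "\<not> C \<subseteq> B"
      using lr by (simp_all add: le_iff Z)
    then have "antichain {A, B, C}" by (simp add: antichain_def)
    then have "cf_distributive M (cf_sublattice M {A, B, C})" using assms(3) Z by simp
    then show ?thesis using S by (simp add: cf_distributive_def cf_sublattice.generator)
  qed
  have "planar_join_distributive ?Z f g"
    unfolding planar_join_distributive_def
  proof (intro conjI ballI impI)
    fix A B C F
    assume Z: "A \<in> ?Z" "B \<in> ?Z" "C \<in> ?Z" and F: "F \<in> ?Z" "C \<subseteq> F"
      and lr: "f A < f B" "f B < f C" "g C < g B" "g B < g A"
      and low: "\<forall>G\<in>?Z. G \<subseteq> A \<longrightarrow> G \<subseteq> B \<longrightarrow> G \<subseteq> F"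
    \<comment> \<open>By coordinates \<open>B\<close> lies below the join of \<open>A\<close> and
      \<open>C\<close>. Distributing its meet with that join leaves a part below both
      \<open>A\<close> and \<open>B\<close> and a part below \<open>C\<close>, both contained in
      \<open>F\<close>.\<close>
    have J: "cf_join M A C \<in> ?Z" using cf_join_cyclic_flat Z by blast
    have "B \<subseteq> cf_join M A C"
      using le_iff[OF Z(2) J] le_iff[OF Z(1) J] le_iff[OF Z(3) J] cf_join_upper[OF Z(1,3)] lr by auto
    then have "B \<subseteq> cf_meet M B (cf_join M A C)" using cf_meet_greatest[OF Z(2)] by blast
    also have "\<dots> = cf_join M (cf_meet M B A) (cf_meet M B C)"
      using distrib[OF lr Z] by simp
    also have "\<dots> \<subseteq> F"
      using low cf_meet_cyclic_flat[OF Z(2,1)] cf_meet_lower[of B A] cf_meet_lower[of B C] F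
      by (intro cf_join_least) auto
    finally show "B \<subseteq> F" .
  qed (use le_iff in blast)
  \<comment> \<open>Complementation reverses inclusion, which the negated coordinates undo.\<close>
  moreover have "planar_join_distributive (cyclic_flats (dual_matroid M))
      (\<lambda>X. - f (?E - X)) (\<lambda>X. - g (?E - X))"
    unfolding planar_join_distributive_def cyclic_flats_dual
  proof (intro conjI ballI impI)
    fix X Y assume "X \<in> cyclic_flats (dual_matroid M)" "Y \<in> cyclic_flats (dual_matroid M)"
    then have XY: "X \<subseteq> ?E" "Y \<subseteq> ?E" "?E - X \<in> ?Z" "?E - Y \<in> ?Z" by (auto simp: cyclic_flats_dual)
    then have "X \<subseteq> Y \<longleftrightarrow> ?E - Y \<subseteq> ?E - X" by blast
    then show "X \<subseteq> Y \<longleftrightarrow> - f (?E - X) \<le> - f (?E - Y) \<and> - g (?E - X) \<le> - g (?E - Y)"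
      using le_iff[OF XY(4,3)] by simp
  next
    fix A' B' C' F'
    assume D: "A' \<in> cyclic_flats (dual_matroid M)" "B' \<in> cyclic_flats (dual_matroid M)"
        "C' \<in> cyclic_flats (dual_matroid M)" "F' \<in> cyclic_flats (dual_matroid M)"
      and lr': "- f (?E - A') < - f (?E - B')" "- f (?E - B') < - f (?E - C')"
        "- g (?E - C') < - g (?E - B')" "- g (?E - B') < - g (?E - A')"
      and "C' \<subseteq> F'"
      and low: "\<forall>G\<in>cyclic_flats (dual_matroid M). G \<subseteq> A' \<longrightarrow> G \<subseteq> B' \<longrightarrow> G \<subseteq> F'"
    \<comment> \<open>Back in \<open>M\<close>, the goal says that \<open>F\<close> lies below
      \<open>B\<close> if it lies below \<open>C\<close> and below the join of \<open>A\<close> and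
      \<open>B\<close>. Distributing the meet of \<open>C\<close> with that join works, as the meet
      of \<open>C\<close> and \<open>A\<close> lies below \<open>B\<close> by coordinates.\<close>
    define A B C F where "A = ?E - A'" and "B = ?E - B'" and "C = ?E - C'" and "F = ?E - F'"
    note defs = A_def B_def C_def F_def
    have Z: "A \<in> ?Z" "B \<in> ?Z" "C \<in> ?Z" "F \<in> ?Z" and sub: "A' \<subseteq> ?E" "B' \<subseteq> ?E" "C' \<subseteq> ?E" "F' \<subseteq> ?E"
      using D by (auto simp: defs cyclic_flats_dual)
    have lr: "f C < f B" "f B < f A" "g A < g B" "g B < g C" using lr' by (simp_all add: defs)
    let ?J = "cf_join M A B"
    have J: "?J \<in> ?Z" using cf_join_cyclic_flat Z by blast
    have JE: "?J \<subseteq> ?E" using cyclic_flat_subset_ground[OF J] .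
    have "?E - ?J \<in> cyclic_flats (dual_matroid M)" using J JE by (simp add: cyclic_flats_dual double_diff)
    moreover have "?E - ?J \<subseteq> A'" "?E - ?J \<subseteq> B'" using cf_join_upper[OF Z(1,2)] by (auto simp: defs)
    ultimately have "?E - ?J \<subseteq> F'" using low by blast
    then have "F \<subseteq> ?J" by (auto simp: defs)
    moreover have "F \<subseteq> C" using \<open>C' \<subseteq> F'\<close> by (auto simp: defs)
    ultimately have "F \<subseteq> cf_meet M C ?J" using cf_meet_greatest[OF Z(4)] by blast
    also have "\<dots> = cf_join M (cf_meet M C A) (cf_meet M C B)"
      using distrib[OF lr Z(3,2,1)] by simp
    also have "\<dots> \<subseteq> B"
    proof (rule cf_join_least[OF Z(2)])
      have L: "cf_meet M C A \<in> ?Z" using cf_meet_cyclic_flat Z by blast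
      show "cf_meet M C A \<subseteq> B"
        using le_iff[OF L Z(2)] le_iff[OF L Z(3)] le_iff[OF L Z(1)] cf_meet_lower[of C A] lr by auto
    qed (rule cf_meet_lower)
    finally show "B' \<subseteq> F'" using sub by (auto simp: defs)
  qed
  ultimately show ?thesis
    using minor_transversal[OF assms(1)] minor_transversal[OF matroid_dual] minor_dual by blast
qed

end
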